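(* Let $\mathcal N:\mathbb R^{n_0}\to\mathbb R^{n_L}$ be a random fully connected ReLU network as described in the context. Let $d$ be a positive integer with $d\le\min\{n_0,\dots,n_L\}$ and let $M\subseteq\mathbb R^{n_0}$ be a compact smooth $d$-dimensional submanifold with $\mathrm{vol}_d(M)=1$. Then both $\big(\mathbb E[\mathrm{vol}_d(\mathcal N(M))]\big)^2$ and $\mathrm{Var}[\mathrm{vol}_d(\mathcal N(M))]$ are bounded above by $$\Big(\frac{n_L}{n_0}\Big)^d\exp\Big[-\binom d2\sum_{\ell=1}^{L}n_\ell^{-1}\Big].$$
   Context: Fix integers $L\ge1$ and $n_0,\dots,n_L\ge1$. The network $\mathcal N:\mathbb R^{n_0}\to\mathbb R^{n_L}$ with hidden widths $n_1,\dots,n_{L-1}$ is defined by $z^{(1)}(x)=W^{(1)}x+b^{(1)}$, $z^{(\ell)}(x)=W^{(\ell)}\,\mathrm{ReLU}(z^{(\ell-1)}(x))+b^{(\ell)}$ for $2\le\ell\le L$, and $\mathcal N(x)=z^{(L)}(x)$, where $\mathrm{ReLU}(t)=\max(t,0)$ is applied componentwise, $W^{(\ell)}$ is an $n_\ell\times n_{\ell-1}$ matrix and $b^{(\ell)}\in\mathbb R^{n_\ell}$. All entries of all $W^{(\ell)}$ and $b^{(\ell)}$ are independent centered Gaussian random variables with $\mathrm{Var}(W^{(\ell)}_{ij})=2/n_{\ell-1}$ for $1\le\ell\le L-1$, $\mathrm{Var}(W^{(L)}_{ij})=1/n_{L-1}$, and $\mathrm{Var}(b^{(\ell)}_j)=C_b$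 for a fixed constant $C_b>0$. The Jacobian $J_x=(\partial\mathcal N_i/\partial x_j(x))_{1\le i\le n_L,1\le j\le n_0}$ exists for Lebesgue-almost every $x$. For vectors $v_1,\dots,v_d$, $\|v_1\wedge\cdots\wedge v_d\|^2:=\det(\langle v_i,v_j\rangle)_{i,j=1}^d$. With $e_1(x),\dots,e_d(x)$ an orthonormal basis of the tangent space $T_xM$ and $\mathrm{vol}_d$ the $d$-dimensional Hausdorff measure on $M$, $\mathrm{vol}_d(\mathcal N(M)):=\int_M\|J_xe_1(x)\wedge\cdots\wedge J_xe_d(x)\|\,\mathrm{vol}_d(dx)$ (the $d$-dimensional volume of the image counted with multiplicity). *)

theory Defs
  imports "HOL-Analysis.Analysis" "HOL-Probability.Probability"
begin

text \<open>C-infinity on an open set V: f lies in a family of functions that is closed under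
  taking directional derivatives and all of whose members are differentiable on V.
  (Equivalently: all iterated directional derivatives of f exist on V.)\<close>
definition smooth_on :: "'a::euclidean_space set \<Rightarrow> ('a \<Rightarrow> 'b::euclidean_space) \<Rightarrow> bool" where
  "smooth_on V f \<longleftrightarrow>
     (\<exists>F. f \<in> F \<and> (\<forall>g\<in>F. (\<forall>x\<in>V. g differentiable (at x)) \<and>
                         (\<forall>v. (\<lambda>x. frechet_derivative g (at x) v) \<in> F)))"

definition smooth_submanifold :: "'d::euclidean_space itself \<Rightarrow> 'n::euclidean_space set \<Rightarrow> bool" where
  "smooth_submanifold _ M \<longleftrightarrow>
     (\<forall>p\<in>M. \<exists>U (V::'d set) (\<phi>::'d \<Rightarrow> 'n).
        open U \<and> p \<in> U \<and> open V \<and> smooth_on V \<phi> \<and> inj_on \<phi> V \<and> \<phi> ` V = M \<inter> U \<and>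
        continuous_on (M \<inter> U) (inv_into V \<phi>) \<and>
        (\<forall>u\<in>V. inj (frechet_derivative \<phi> (at u))))"

definition tangent_space :: "'n::euclidean_space set \<Rightarrow> 'n \<Rightarrow> 'n set" where
  "tangent_space M x = {v. \<exists>\<gamma>::real \<Rightarrow> 'n. \<gamma> 0 = x \<and> (\<forall>t. \<gamma> t \<in> M) \<and> (\<gamma> has_vector_derivative v) (at 0)}"

definition tangent_frame :: "'d::finite itself \<Rightarrow> 'n::euclidean_space set \<Rightarrow> 'n \<Rightarrow> 'd \<Rightarrow> 'n" where
  "tangent_frame _ M x = (SOME e::'d \<Rightarrow> 'n. (\<forall>i j. e i \<bullet> e j = (if i = j then 1 else 0)) \<and>
                                     span (range e) = tangent_space M x)"

definition wedge_norm :: "('d::finite \<Rightarrow> 'b::real_inner) \<Rightarrow> real" where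
  "wedge_norm v = sqrt (det (\<chi> i j. v i \<bullet> v j :: real^'d^'d))"

definition hausdorff_outer :: "nat \<Rightarrow> 'a::metric_space set \<Rightarrow> ennreal" where
  "hausdorff_outer s A =
     (SUP \<delta>\<in>{0::real<..}. INF C\<in>{C::nat \<Rightarrow> 'a set. A \<subseteq> (\<Union>i. C i) \<and> (\<forall>i. bounded (C i) \<and> diameter (C i) \<le> \<delta>)}.
        (\<Sum>i. ennreal (unit_ball_vol (real s) * (diameter (C i) / 2) ^ s)))"

definition hausdorff_measure :: "nat \<Rightarrow> 'a::metric_space measure" where
  "hausdorff_measure s = measure_of UNIV (sets borel) (hausdorff_outer s)"

definition jac_apply :: "('a::real_normed_vector \<Rightarrow> 'b::real_normed_vector) \<Rightarrow> 'a \<Rightarrow> 'a \<Rightarrow> 'b" where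
  "jac_apply N x v = (if N differentiable (at x) then frechet_derivative N (at x) v else 0)"

text \<open>vol_d(N(M)) counted with multiplicity, d = CARD('d).\<close>
definition image_volume :: "'d::finite itself \<Rightarrow> (real^'n) set \<Rightarrow> (real^'n \<Rightarrow> real^'m) \<Rightarrow> real" where
  "image_volume T M N =
     (LINT x:M|hausdorff_measure CARD('d). wedge_norm (\<lambda>i::'d. jac_apply N x (tangent_frame T M x i)))"

text \<open>A fixed enumeration of a finite type by 0..CARD-1 (the statement does not depend on it).\<close>
definition coord_idx :: "'a::finite \<Rightarrow> nat" where
  "coord_idx = (SOME f. bij_betw f UNIV {..<CARD('a)})"

text \<open>Parameters: Wt l i j = entry (i,j) of W^(l);  Bs l i = entry i of b^(l).\<close>
datatype pidx = Wt nat nat nat | Bs nat nat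

primrec act :: "(nat \<Rightarrow> nat) \<Rightarrow> (pidx \<Rightarrow> real) \<Rightarrow> nat \<Rightarrow> real^'n \<Rightarrow> nat \<Rightarrow> real" where
  "act w th 0 x = (\<lambda>j. x $ inv_into UNIV coord_idx j)"
| "act w th (Suc l) x =
     (\<lambda>i. max ((\<Sum>j<w l. th (Wt (Suc l) i j) * act w th l x j) + th (Bs (Suc l) i)) 0)"

definition net :: "(nat \<Rightarrow> nat) \<Rightarrow> nat \<Rightarrow> (pidx \<Rightarrow> real) \<Rightarrow> real^'n \<Rightarrow> real^'m" where
  "net w L th x = (\<chi> k. (\<Sum>j<w (L - 1). th (Wt L (coord_idx k) j) * act w th (L - 1) x j)
                        + th (Bs L (coord_idx k)))"

definition param_set :: "(nat \<Rightarrow> nat) \<Rightarrow> nat \<Rightarrow> pidx set" where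
  "param_set w L = {Wt l i j | l i j. 1 \<le> l \<and> l \<le> L \<and> i < w l \<and> j < w (l - 1)}
                 \<union> {Bs l i | l i. 1 \<le> l \<and> l \<le> L \<and> i < w l}"

fun param_var :: "(nat \<Rightarrow> nat) \<Rightarrow> nat \<Rightarrow> real \<Rightarrow> pidx \<Rightarrow> real" where
  "param_var w L Cb (Wt l i j) = (if l < L then 2 / real (w (l - 1)) else 1 / real (w (l - 1)))"
| "param_var w L Cb (Bs l i) = Cb"

definition param_measure :: "(nat \<Rightarrow> nat) \<Rightarrow> nat \<Rightarrow> real \<Rightarrow> (pidx \<Rightarrow> real) measure" where
  "param_measure w L Cb =
     PiM (param_set w L) (\<lambda>k. density lborel (normal_density 0 (sqrt (param_var w L Cb k))))"

end

(* By Cauchy-Schwarz on M, which has volume 1, vol_d(N(M))^2 is at most the integral over M of the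
   squared wedge norm of the Jacobian, so by Tonelli it suffices to bound, at a fixed point x and
   for a frame e, the expectation of det (Gram (J_x e)).  This is done layer by layer: if Y_1, ..., Y_n
   are i.i.d. random vectors in R^d, then multilinearity of the determinant gives
   E det (sum_i Y_i Y_i^T) = n (n-1) ... (n-d+1) det (E Y Y^T), because only the injective
   choices of rows contribute.  Conditionally on the previous layers the rows of the gated weight matrix
   applied to the frame are i.i.d.; flipping the signs of all parameters of the layer shows
   that the ReLU gate halves the second moment, which cancels the factor 2 in the variance.  Each
   layer thus contributes n_l (n_l - 1) ... (n_l - d + 1) / n_{l-1}^d, and 1 - t <= exp (-t).
   For almost every choice of the parameters no preactivation vanishes at almost every point
   of M, so the Jacobian is the formal product of the layers. *)

theory Submission
  imports Defs
begin

section \<open>Determinants of Gram matrices\<close>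

text \<open>One estimate serves both claims: the second moment of the image volume dominates its
  squared mean and its variance. Two obstacles shape the proof. \<open>tangent_frame\<close> is
  picked by \<open>SOME\<close>, so nothing is known about its dependence on the point; Tonelli is
  therefore applied to a different, measurable frame glued from derivatives of charts, and a
  quotient of Gram determinants converts one frame into the other. Moreover \<open>M\<close> may be
  a Lebesgue null set of the input space, so differentiability of the network at Lebesgue-almost
  every point says nothing on \<open>M\<close>. The biases close this gap: as C_b > 0, at each fixed
  point every hidden preactivation is almost surely nonzero, and Fubini exchanges "almost every
  parameter" and "almost every point". The output layer has no gate to halve its second moment,
  which is why its variance 1/n matches the variance 2/n of the hidden layers; the factors n_l^d /
  n_{l-1}^d then telescope to (n_L/n_0)^d.\<close>

lemma det_sum_products:
  fixes Y Z :: "'i \<Rightarrow> 'd::finite \<Rightarrow> real"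
  assumes "finite S"
  shows "det (\<chi> a b. \<Sum>i\<in>S. Y i a * Z i b)
    = (\<Sum>f\<in>UNIV \<rightarrow>\<^sub>E S. (\<Prod>a\<in>UNIV. Y (f a) a) * det (\<chi> a b. Z (f a) b))"
proof -
  have "det (\<chi> a b. \<Sum>i\<in>S. Y i a * Z i b)
     = (\<Sum>p | p permutes UNIV. of_int (sign p) * (\<Prod>a\<in>UNIV. \<Sum>i\<in>S. Y i a * Z i (p a)))"
    by (simp add: det_def)
  \<comment> \<open>Row \<open>a\<close> is a combination of the rows \<open>Z i\<close> with
    weights \<open>Y i a\<close>; \<open>f\<close> records which summand each row contributes. The
    result is the Cauchy-Binet expansion before terms with equal image are grouped.\<close>
  also have "\<dots> = (\<Sum>p | p permutes UNIV. \<Sum>f\<in>UNIV \<rightarrow>\<^sub>E S.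
      of_int (sign p) * ((\<Prod>a\<in>UNIV. Y (f a) a) * (\<Prod>a\<in>UNIV. Z (f a) (p a))))"
    using assms by (simp add: prod_sum_PiE sum_distrib_left prod.distrib)
  also have "\<dots> = (\<Sum>f\<in>UNIV \<rightarrow>\<^sub>E S. \<Sum>p | p permutes UNIV.
      of_int (sign p) * ((\<Prod>a\<in>UNIV. Y (f a) a) * (\<Prod>a\<in>UNIV. Z (f a) (p a))))"
    by (rule sum.swap)
  also have "\<dots> = (\<Sum>f\<in>UNIV \<rightarrow>\<^sub>E S. (\<Prod>a\<in>UNIV. Y (f a) a) * det (\<chi> a b. Z (f a) b))"
    by (simp add: det_def sum_distrib_left mult_ac)
  finally show ?thesis .
qed

lemma det_non_inj_rows:
  fixes Z :: "'i \<Rightarrow> 'd::finite \<Rightarrow> real"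
  assumes "\<not> inj f"
  shows "det (\<chi> a b. Z (f a) b) = 0"
proof -
  obtain a b where "a \<noteq> b" "f a = f b" using assms by (auto simp: inj_def)
  then show ?thesis by (intro det_identical_rows[of a b]) (auto simp: row_def)
qed

lemma card_inj_PiE:
  assumes "finite S"
  shows "real (card {f \<in> (UNIV :: 'd::finite set) \<rightarrow>\<^sub>E S. inj f})
    = (\<Prod>j<CARD('d). real (card S) - real j)"
proof -
  have "real (card {f \<in> (UNIV :: 'd set) \<rightarrow>\<^sub>E S. inj f}) = (\<Prod>j<CARD('d). real (card S - j))"
    using card_inj_on_subset_funcset[of "UNIV :: 'd set" S UNIV] assms
    by (simp add: atLeast0LessThan)
  also have "\<dots> = (\<Prod>j<CARD('d). real (card S) - real j)"
  proof (cases "CARD('d) \<le> card S")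
    case True
    then show ?thesis by (intro prod.cong) (auto simp: of_nat_diff)
  next
    case False
    \<comment> \<open>Truncated and real subtraction differ from here on, but both products contain
      the index \<open>j = card S\<close>, where the factor is 0.\<close>
    then have "(\<Prod>j<CARD('d). real (card S - j)) = 0" "(\<Prod>j<CARD('d). real (card S) - real j) = 0"
      by (intro prod_zero bexI[of _ "card S"]; use False in simp)+
    then show ?thesis by (rule trans[OF _ sym])
  qed
  finally show ?thesis .
qed

text \<open>An injective \<open>f\<close> picks distinct rows, for which independence makes the
  expected product factor; this is \<open>H\<close>. The sum over \<open>p\<close> then reassembles
  \<open>det R\<close>, the same value for every \<open>f\<close>, so the constant is the number of
  injections.\<close>

lemma has_bochner_integral_det_gram:
  fixes Y :: "'i \<Rightarrow> 'd::finite \<Rightarrow> 'w \<Rightarrow> real"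
  assumes "finite S"
    and H: "\<And>f p. f \<in> UNIV \<rightarrow>\<^sub>E S \<Longrightarrow> inj f \<Longrightarrow>
      has_bochner_integral M (\<lambda>\<omega>. \<Prod>a\<in>UNIV. Y (f a) a \<omega> * Y (f a) (p a) \<omega>) (\<Prod>a\<in>UNIV. R a (p a))"
  shows "has_bochner_integral M (\<lambda>\<omega>. det (\<chi> a b. \<Sum>i\<in>S. Y i a \<omega> * Y i b \<omega>))
           ((\<Prod>j<CARD('d). real (card S) - real j) * det (\<chi> a b. R a b))"
proof -
  let ?F = "{f \<in> (UNIV :: 'd set) \<rightarrow>\<^sub>E S. inj f}"
  have fin: "finite ((UNIV :: 'd set) \<rightarrow>\<^sub>E S)" using assms(1) by (intro finite_PiE) auto
  have "det (\<chi> a b. \<Sum>i\<in>S. Y i a \<omega> * Y i b \<omega>)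
    = (\<Sum>f\<in>?F. \<Sum>p | p permutes UNIV. of_int (sign p) * (\<Prod>a\<in>UNIV. Y (f a) a \<omega> * Y (f a) (p a) \<omega>))"
    for \<omega>
  proof -
    have "det (\<chi> a b. \<Sum>i\<in>S. Y i a \<omega> * Y i b \<omega>)
      = (\<Sum>f\<in>UNIV \<rightarrow>\<^sub>E S. (\<Prod>a\<in>UNIV. Y (f a) a \<omega>) * det (\<chi> a b. Y (f a) b \<omega>))"
      using assms(1) by (rule det_sum_products)
    also have "\<dots> = (\<Sum>f\<in>?F. (\<Prod>a\<in>UNIV. Y (f a) a \<omega>) * det (\<chi> a b. Y (f a) b \<omega>))"
      using fin by (intro sum.mono_neutral_right) (auto simp: det_non_inj_rows[where Z = "\<lambda>i b. Y i b \<omega>"])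
    finally show ?thesis
      by (simp add: det_def sum_distrib_left prod.distrib mult_ac)
  qed
  moreover have "has_bochner_integral M (\<lambda>\<omega>. \<Sum>f\<in>?F. \<Sum>p | p permutes UNIV.
        of_int (sign p) * (\<Prod>a\<in>UNIV. Y (f a) a \<omega> * Y (f a) (p a) \<omega>))
      (\<Sum>f\<in>?F. \<Sum>p | p permutes UNIV. of_int (sign p) * (\<Prod>a\<in>UNIV. R a (p a)))"
    by (intro has_bochner_integral_sum has_bochner_integral_mult_right H) auto
  ultimately have "has_bochner_integral M (\<lambda>\<omega>. det (\<chi> a b. \<Sum>i\<in>S. Y i a \<omega> * Y i b \<omega>))
      (\<Sum>f\<in>?F. \<Sum>p | p permutes UNIV. of_int (sign p) * (\<Prod>a\<in>UNIV. R a (p a)))"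
    by simp
  also have "(\<Sum>f\<in>?F. \<Sum>p | p permutes UNIV. of_int (sign p) * (\<Prod>a\<in>UNIV. R a (p a)))
     = (\<Prod>j<CARD('d). real (card S) - real j) * det (\<chi> a b. R a b)"
    by (simp add: det_def card_inj_PiE[OF assms(1)])
  finally show ?thesis .
qed

text \<open>Positive definiteness keeps the determinant from vanishing along the segment from the
  identity matrix to the Gram matrix.\<close>
lemma det_gram_nonneg:
  fixes Y :: "'i \<Rightarrow> 'd::finite \<Rightarrow> real"
  assumes "finite S"
  shows "0 \<le> det (\<chi> a b. \<Sum>i\<in>S. Y i a * Y i b)"
proof (rule ccontr)
  assume neg: "\<not> ?thesis"
  define G :: "real \<Rightarrow> real^'d^'d"
    where "G t = (\<chi> a b. (1 - t) * (if a = b then 1 else 0) + t * (\<Sum>i\<in>S. Y i a * Y i b))" for t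
  have G0: "G 0 = mat 1" by (simp add: G_def mat_def)
  have G1: "det (G 1) < 0" using neg by (simp add: G_def)
  have "continuous_on {0..1} (\<lambda>t. det (G t))"
    unfolding det_def G_def by (auto intro!: continuous_intros)
  then obtain t where t: "0 \<le> t" "t \<le> 1" "det (G t) = 0"
    using IVT2'[of "\<lambda>t. det (G t)" 1 0 0] G0 G1 by auto
  then have "t < 1" using G1 by (cases "t = 1") auto
  have "\<not> invertible (G t)" using t invertible_det_nz by blast
  then obtain v where v: "v \<noteq> 0" "G t *v v = 0"
    using matrix_left_invertible_ker[of "G t"] invertible_left_inverse[of "G t"] by auto
  have "v \<bullet> (G t *v v) = (\<Sum>a\<in>UNIV. \<Sum>b\<in>UNIV. v $ a * (G t $ a $ b) * v $ b)"
    by (simp add: inner_vec_def matrix_vector_mult_def sum_distrib_left mult_ac)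
  also have "\<dots> = (1 - t) * (v \<bullet> v) + t * (\<Sum>a\<in>UNIV. \<Sum>b\<in>UNIV. \<Sum>i\<in>S. (v $ a * Y i a) * (v $ b * Y i b))"
  proof -
    have "v $ a * (G t $ a $ b) * v $ b = (1 - t) * (if a = b then v $ a * v $ b else 0)
        + t * (\<Sum>i\<in>S. (v $ a * Y i a) * (v $ b * Y i b))" for a b
      by (simp add: G_def algebra_simps sum_distrib_left)
    then show ?thesis
      by (simp add: sum.distrib inner_vec_def flip: sum_distrib_left)
  qed
  also have "(\<Sum>a\<in>UNIV. \<Sum>b\<in>UNIV. \<Sum>i\<in>S. (v $ a * Y i a) * (v $ b * Y i b))
     = (\<Sum>i\<in>S. (\<Sum>a\<in>UNIV. v $ a * Y i a)\<^sup>2)"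
  proof -
    have "(\<Sum>a\<in>UNIV. \<Sum>b\<in>UNIV. \<Sum>i\<in>S. (v $ a * Y i a) * (v $ b * Y i b))
      = (\<Sum>a\<in>UNIV. \<Sum>i\<in>S. \<Sum>b\<in>UNIV. (v $ a * Y i a) * (v $ b * Y i b))"
      by (intro sum.cong refl sum.swap)
    also have "\<dots> = (\<Sum>i\<in>S. \<Sum>a\<in>UNIV. \<Sum>b\<in>UNIV. (v $ a * Y i a) * (v $ b * Y i b))"
      by (rule sum.swap)
    finally show ?thesis by (simp add: power2_eq_square sum_product)
  qed
  finally have "(1 - t) * (v \<bullet> v) + t * (\<Sum>i\<in>S. (\<Sum>a\<in>UNIV. v $ a * Y i a)\<^sup>2) = 0"
    using v by simp
  moreover have "0 < (1 - t) * (v \<bullet> v)" using \<open>t < 1\<close> v by simp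
  moreover have "0 \<le> t * (\<Sum>i\<in>S. (\<Sum>a\<in>UNIV. v $ a * Y i a)\<^sup>2)"
    using t by (intro mult_nonneg_nonneg sum_nonneg) auto
  ultimately show False by linarith
qed

text \<open>The binomial coefficient in the final exponent originates here: each factor is
  \<open>n * (1 - j/n)\<close>, and the exponents \<open>j/n\<close> with \<open>j < d\<close> add
  up to (d choose 2)/n. The condition \<open>d \<le> n\<close> keeps the factors nonnegative, so
  that the inequalities may be multiplied.\<close>

lemma falling_factorial_le:
  fixes n d :: nat
  assumes "d \<le> n" "1 \<le> n"
  shows "(\<Prod>j<d. real n - real j) \<le> real n ^ d * exp (- real (d choose 2) * (1 / real n))"
proof -
  have "(\<Prod>j<d. real n - real j) \<le> (\<Prod>j<d. real n * exp (- (real j / real n)))"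
  proof (rule prod_mono)
    fix j assume "j \<in> {..<d}"
    then have "j \<le> n" using assms by auto
    have "1 - real j / real n \<le> exp (- (real j / real n))"
      using exp_ge_add_one_self[of "- (real j / real n)"] by simp
    then have "real n * (1 - real j / real n) \<le> real n * exp (- (real j / real n))"
      by (intro mult_left_mono) auto
    then show "0 \<le> real n - real j \<and> real n - real j \<le> real n * exp (- (real j / real n))"
      using assms \<open>j \<le> n\<close> by (simp add: right_diff_distrib)
  qed
  also have "\<dots> = real n ^ d * exp (- (\<Sum>j<d. real j) / real n)"
    by (simp add: prod.distrib exp_sum sum_negf sum_divide_distrib flip: sum_negf)
  also have "(\<Sum>j<d. real j) = real (d choose 2)"
    by (induction d) (simp_all add: numeral_2_eq_2)
  finally show ?thesis by simp
qed

section \<open>Gaussian layers\<close>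

definition centered_normal :: "real \<Rightarrow> real measure" where
  "centered_normal s = density lborel (normal_density 0 (sqrt s))"

lemma sets_centered_normal [measurable_cong, simp]: "sets (centered_normal s) = sets borel"
  by (simp add: centered_normal_def)

lemma space_centered_normal [simp]: "space (centered_normal s) = UNIV"
  by (simp add: centered_normal_def)

lemma prob_space_centered_normal: "0 < s \<Longrightarrow> prob_space (centered_normal s)"
  unfolding centered_normal_def by (rule prob_space_normal_density) simp

lemma distr_uminus_centered_normal:
  "distr (centered_normal s) (centered_normal s) uminus = centered_normal s"
proof -
  have "distr (density lborel (\<lambda>x. ennreal (normal_density 0 (sqrt s) (- x)))) lborel uminus
      = density (distr lborel lborel uminus) (\<lambda>x. ennreal (normal_density 0 (sqrt s) x))"
    by (intro density_distr[symmetric]) auto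
  moreover have "distr lborel lborel uminus = (lborel :: real measure)"
    using lborel_distr_uminus by (metis distr_cong sets_lborel)
  moreover have "normal_density 0 (sqrt s) (- x) = normal_density 0 (sqrt s) x" for x
    by (simp add: normal_density_def)
  ultimately show ?thesis
    unfolding centered_normal_def by (simp cong: distr_cong)
qed

lemma AE_centered_normal_neq: "AE x in centered_normal s. x \<noteq> c"
  unfolding centered_normal_def using AE_lborel_singleton[of c] by (auto simp: AE_density)

lemma centered_normal_moments:
  assumes "0 < s"
  shows "has_bochner_integral (centered_normal s) (\<lambda>x. x) 0"
    and "has_bochner_integral (centered_normal s) (\<lambda>x. x\<^sup>2) s"
proof -
  show "has_bochner_integral (centered_normal s) (\<lambda>x. x) 0"
    using normal_moment_nz_1[of "sqrt s" 0] assms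
    unfolding centered_normal_def by (intro has_bochner_integral_density) auto
  show "has_bochner_integral (centered_normal s) (\<lambda>x. x\<^sup>2) s"
    using normal_moment_even[of "sqrt s" 0 1] assms
    unfolding centered_normal_def by (intro has_bochner_integral_density) auto
qed

text \<open>Positivity is demanded at every index and not just on \<open>I\<close>, because
  \<open>product_prob_space\<close> asks that every factor be a probability measure.\<close>

locale gaussian_family =
  fixes v :: "'k \<Rightarrow> real" and I :: "'k set"
  assumes v_pos: "\<And>k. 0 < v k" and finite_I: "finite I"
begin

abbreviation "\<N> k \<equiv> centered_normal (v k)"
abbreviation "\<P> \<equiv> PiM I \<N>"

lemma prob_space_N: "prob_space (\<N> k)"
  using v_pos by (rule prob_space_centered_normal)

sublocale product_prob_space \<N> I
  by (simp add: product_prob_spaceI prob_space_N)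

lemma sets_P: "sets (PiM J \<N>) = sets (PiM J (\<lambda>_. borel))"
  by (intro sets_PiM_cong) auto

text \<open>Outside of \<open>J\<close> the points of \<open>PiM J\<close> are constantly \<open>undefined\<close>, so no membership
  condition is needed.\<close>
lemma measurable_coordinate [measurable]: "(\<lambda>\<theta>. \<theta> k) \<in> borel_measurable (PiM J \<N>)"
proof (cases "k \<in> J")
  case True
  then show ?thesis using measurable_component_singleton[of k J \<N>] by (simp cong: measurable_cong_sets)
next
  case False
  then show ?thesis
    by (subst measurable_cong[where g = "\<lambda>_. undefined"]) (auto simp: space_PiM PiE_def extensional_def)
qed

lemma coordinate_moments:
  assumes "k \<in> I"
  shows "has_bochner_integral \<P> (\<lambda>\<theta>. \<theta> k) 0"
    and "has_bochner_integral \<P> (\<lambda>\<theta>. (\<theta> k)\<^sup>2) (v k)"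
proof -
  have D: "distr \<P> (\<N> k) (\<lambda>\<theta>. \<theta> k) = \<N> k"
    using assms by (intro distr_PiM_component prob_space_N)
  have M: "(\<lambda>\<theta>. \<theta> k) \<in> measurable \<P> (\<N> k)" using assms by simp
  have transfer: "has_bochner_integral \<P> (\<lambda>\<theta>. f (\<theta> k)) r"
    if "has_bochner_integral (\<N> k) f r" and "f \<in> borel_measurable borel" for f :: "real \<Rightarrow> real" and r
  proof -
    have f: "f \<in> borel_measurable (\<N> k)" using that(2) by (simp cong: measurable_cong_sets)
    show ?thesis
      using that(1) integrable_distr_eq[OF M f] integral_distr[OF M f]
      unfolding D has_bochner_integral_iff by simp
  qed
  show "has_bochner_integral \<P> (\<lambda>\<theta>. \<theta> k) 0"
    using centered_normal_moments(1)[OF v_pos] by (rule transfer) simp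
  show "has_bochner_integral \<P> (\<lambda>\<theta>. (\<theta> k)\<^sup>2) (v k)"
    using centered_normal_moments(2)[OF v_pos] by (rule transfer) simp
qed

lemma indep_coordinates: "P.indep_vars (\<lambda>_. borel) (\<lambda>k \<theta>. \<theta> k) I"
proof (cases "I = {}")
  case False
  have 1: "distr \<P> (PiM I (\<lambda>_. borel)) (\<lambda>\<theta>. \<lambda>k\<in>I. \<theta> k) = \<P>"
  proof -
    have "distr \<P> (PiM I (\<lambda>_. borel)) (\<lambda>\<theta>. \<lambda>k\<in>I. \<theta> k) = distr \<P> \<P> (\<lambda>\<theta>. \<theta>)"
      by (intro distr_cong) (auto simp: sets_P space_PiM)
    then show ?thesis by simp
  qed
  have 2: "PiM I (\<lambda>k. distr \<P> borel (\<lambda>\<theta>. \<theta> k)) = \<P>"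
  proof (intro PiM_cong refl)
    fix k assume "k \<in> I"
    have "distr \<P> borel (\<lambda>\<theta>. \<theta> k) = distr \<P> (\<N> k) (\<lambda>\<theta>. \<theta> k)"
      by (intro distr_cong) auto
    then show "distr \<P> borel (\<lambda>\<theta>. \<theta> k) = \<N> k"
      using distr_PiM_component[of I \<N>, OF prob_space_N \<open>k \<in> I\<close>] by (rule trans)
  qed
  show ?thesis
    using False 1 2 by (subst P.indep_vars_iff_distr_eq_PiM') auto
next
  case True
  show ?thesis unfolding P.indep_vars_def P.indep_sets_def by (simp add: True)
qed

lemma coordinate_covariance:
  assumes "k \<in> I" "j \<in> I"
  shows "has_bochner_integral \<P> (\<lambda>\<theta>. \<theta> k * \<theta> j) (if k = j then v k else 0)"
proof (cases "k = j")
  case True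
  then show ?thesis using coordinate_moments(2)[OF assms(1)] by (simp add: power2_eq_square)
next
  case False
  have ind: "P.indep_vars (\<lambda>_. borel) (\<lambda>k \<theta>. \<theta> k) {k, j}"
    using indep_coordinates by (rule P.indep_vars_subset) (use assms in auto)
  have int: "integrable \<P> (\<lambda>\<theta>. \<theta> i)" if "i \<in> {k, j}" for i
    using that assms coordinate_moments(1) by (auto dest: has_bochner_integral_integrable simp: integrable.simps)
  have 0: "(\<integral>\<theta>. \<theta> k \<partial>\<P>) = 0"
    using coordinate_moments(1)[OF assms(1)] by (rule has_bochner_integral_integral_eq)
  show ?thesis
    using P.indep_vars_integrable[OF _ ind int] P.indep_vars_lebesgue_integral[OF _ ind int] False 0
    by (simp add: has_bochner_integral_iff)
qed

text \<open>Each factor is symmetric, so a simultaneous sign flip preserves the product; restricting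
  to \<open>I\<close> keeps the flipped point extensional, hence in the space of
  \<open>\<P>\<close>.\<close>

lemma distr_uminus: "distr \<P> \<P> (\<lambda>\<theta>. \<lambda>k\<in>I. - \<theta> k) = \<P>"
proof -
  have "distr \<P> \<P> (compose I uminus) = PiM I (\<lambda>k. distr (\<N> k) (\<N> k) uminus)"
    by (intro distr_PiM_finite_prob_space finite_I)
      (auto intro: product_prob_spaceI prob_space_N cong: measurable_cong_sets)
  then show ?thesis by (simp add: distr_uminus_centered_normal compose_def[abs_def])
qed

text \<open>Integrate over coordinate \<open>k\<close> before the others: once these are fixed,
  \<open>g\<close> is a constant, and a law with a density gives a single point mass 0.\<close>

lemma AE_coordinate_neq:
  assumes "k \<in> I" and [measurable]: "g \<in> borel_measurable \<P>"
    and g: "\<And>\<theta> y. g (\<theta>(k := y)) = g \<theta>"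
  shows "AE \<theta> in \<P>. \<theta> k \<noteq> g \<theta>"
proof -
  define J where "J = I - {k}"
  have J: "I = insert k J" "finite J" "k \<notin> J" using assms(1) finite_I by (auto simp: J_def)
  have [measurable]: "{\<theta> \<in> space \<P>. \<theta> k = g \<theta>} \<in> sets \<P>"
    by measurable
  have "emeasure \<P> {\<theta> \<in> space \<P>. \<theta> k = g \<theta>}
      = (\<integral>\<^sup>+ \<theta>. indicator {\<theta> \<in> space \<P>. \<theta> k = g \<theta>} \<theta> \<partial>PiM (insert k J) \<N>)"
    by (simp flip: J(1))
  also have "\<dots> = (\<integral>\<^sup>+ \<theta>. (\<integral>\<^sup>+ y. indicator {\<theta> \<in> space \<P>. \<theta> k = g \<theta>} (\<theta>(k := y)) \<partial>\<N> k) \<partial>PiM J \<N>)"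
    using J by (intro product_nn_integral_insert) (auto simp flip: J(1))
  also have "\<dots> = (\<integral>\<^sup>+ \<theta>. 0 \<partial>PiM J \<N>)"
  proof (intro nn_integral_cong)
    fix \<theta>
    have "AE y in \<N> k. indicator {\<theta> \<in> space \<P>. \<theta> k = g \<theta>} (\<theta>(k := y)) = (0 :: ennreal)"
      using AE_centered_normal_neq[of "g \<theta>"] by eventually_elim (auto simp: g)
    then show "(\<integral>\<^sup>+ y. indicator {\<theta> \<in> space \<P>. \<theta> k = g \<theta>} (\<theta>(k := y)) \<partial>\<N> k) = (0 :: ennreal)"
      by (subst nn_integral_cong_AE[where v = "\<lambda>_. 0"]) auto
  qed
  finally have "emeasure \<P> {\<theta> \<in> space \<P>. \<theta> k = g \<theta>} = 0" by simp
  then show ?thesis by (intro AE_I'[of "{\<theta> \<in> space \<P>. \<theta> k = g \<theta>}"]) (auto simp: null_sets_def)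
qed


text \<open>The gate \<open>\<phi> (z \<theta>)\<close> and the linear forms \<open>y\<close> share
  their weights, so they are not independent; symmetry replaces independence. Flipping all signs
  turns \<open>z\<close> into its negative and fixes the product of two \<open>y\<close>, so twice
  the integral carries the weight \<open>(\<phi> z)\<^sup>2 + (\<phi> (- z))\<^sup>2\<close>, which
  is the constant \<open>2 * c\<close>. The ReLU gate has \<open>c = 1/2\<close>, the constant gate
  1 has \<open>c = 1\<close>. The activations \<open>h\<close> drop out of the result.\<close>

lemma row_second_moment:
  fixes b :: 'k and wt :: "nat \<Rightarrow> 'k" and h :: "nat \<Rightarrow> real" and u :: "nat \<Rightarrow> 'd \<Rightarrow> real"
  assumes wt: "inj_on wt {..<m}" "wt ` {..<m} \<subseteq> I" "b \<notin> wt ` {..<m}" "b \<in> I"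
    and s: "\<And>j. j < m \<Longrightarrow> v (wt j) = s"
    and [measurable]: "\<phi> \<in> borel_measurable borel"
    and \<phi>: "\<And>t. \<bar>\<phi> t\<bar> \<le> 1" "\<And>t. t \<noteq> 0 \<Longrightarrow> (\<phi> t)\<^sup>2 + (\<phi> (- t))\<^sup>2 = 2 * c"
  defines "z \<equiv> \<lambda>\<theta>. (\<Sum>j<m. \<theta> (wt j) * h j) + \<theta> b"
  defines "y \<equiv> \<lambda>a \<theta>. (\<Sum>j<m. \<theta> (wt j) * u j a)"
  shows "has_bochner_integral \<P> (\<lambda>\<theta>. (\<phi> (z \<theta>) * y a \<theta>) * (\<phi> (z \<theta>) * y a' \<theta>))
           (c * s * (\<Sum>j<m. u j a * u j a'))"
proof -
  have [measurable]: "z \<in> borel_measurable \<P>" "\<And>a. y a \<in> borel_measurable \<P>"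
    unfolding z_def y_def by measurable
  let ?Y = "\<lambda>\<theta>. y a \<theta> * y a' \<theta>"
  let ?S = "\<Sum>j<m. u j a * u j a'"
  have "has_bochner_integral \<P> (\<lambda>\<theta>. \<Sum>i<m. \<Sum>j<m. (u i a * u j a') * (\<theta> (wt i) * \<theta> (wt j)))
     (\<Sum>i<m. \<Sum>j<m. (u i a * u j a') * (if wt i = wt j then v (wt i) else 0))"
    using wt by (intro has_bochner_integral_sum has_bochner_integral_mult_right coordinate_covariance) auto
  also have "(\<lambda>\<theta>. \<Sum>i<m. \<Sum>j<m. (u i a * u j a') * (\<theta> (wt i) * \<theta> (wt j))) = ?Y"
    by (simp add: y_def sum_product mult_ac)
  also have "(\<Sum>i<m. \<Sum>j<m. (u i a * u j a') * (if wt i = wt j then v (wt i) else 0))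
      = (\<Sum>i<m. \<Sum>j<m. if j = i then (u i a * u i a') * s else 0)"
    using wt s by (intro sum.cong refl) (auto dest: inj_onD)
  also have "\<dots> = s * ?S" by (simp add: sum_distrib_left mult_ac)
  finally have Y: "has_bochner_integral \<P> ?Y (s * ?S)" .
  have int: "integrable \<P> (\<lambda>\<theta>. (\<phi> (g \<theta>))\<^sup>2 * ?Y \<theta>)" if [measurable]: "g \<in> borel_measurable \<P>" for g
  proof (rule Bochner_Integration.integrable_bound)
    show "integrable \<P> ?Y" using Y by (simp add: has_bochner_integral_iff)
    have "(\<phi> t)\<^sup>2 \<le> 1" for t using \<phi>(1)[of t] by (simp add: abs_square_le_1)
    then have "\<bar>(\<phi> t)\<^sup>2 * r\<bar> \<le> \<bar>r\<bar>" for t r by (simp add: abs_mult mult_left_le_one_le)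
    then show "AE \<theta> in \<P>. norm ((\<phi> (g \<theta>))\<^sup>2 * ?Y \<theta>) \<le> norm (?Y \<theta>)" by simp
  qed measurable
  have "(\<integral>\<theta>. (\<phi> (z \<theta>))\<^sup>2 * ?Y \<theta> \<partial>\<P>) = (\<integral>\<theta>. (\<phi> (z \<theta>))\<^sup>2 * ?Y \<theta> \<partial>distr \<P> \<P> (\<lambda>\<theta>. \<lambda>k\<in>I. - \<theta> k))"
    by (simp add: distr_uminus)
  also have "\<dots> = (\<integral>\<theta>. (\<phi> (z (\<lambda>k\<in>I. - \<theta> k)))\<^sup>2 * ?Y (\<lambda>k\<in>I. - \<theta> k) \<partial>\<P>)"
    by (intro integral_distr) (auto intro!: measurable_restrict cong: measurable_cong_sets)
  also have "\<dots> = (\<integral>\<theta>. (\<phi> (- z \<theta>))\<^sup>2 * ?Y \<theta> \<partial>\<P>)"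
  proof -
    have I: "wt j \<in> I" if "j < m" for j using wt that by auto
    have "z (\<lambda>k\<in>I. - \<theta> k) = - z \<theta>" for \<theta>
      using I wt(4) by (simp add: z_def sum_negf)
    moreover have "y a (\<lambda>k\<in>I. - \<theta> k) = - y a \<theta>" for \<theta> a
      using I by (simp add: y_def sum_negf)
    ultimately show ?thesis by simp
  qed
  finally have "2 * (\<integral>\<theta>. (\<phi> (z \<theta>))\<^sup>2 * ?Y \<theta> \<partial>\<P>)
      = (\<integral>\<theta>. (\<phi> (z \<theta>))\<^sup>2 * ?Y \<theta> + (\<phi> (- z \<theta>))\<^sup>2 * ?Y \<theta> \<partial>\<P>)"
    by (subst Bochner_Integration.integral_add) (auto intro!: int)
  also have "\<dots> = (\<integral>\<theta>. 2 * c * ?Y \<theta> \<partial>\<P>)"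
  proof (intro integral_cong_AE)
    \<comment> \<open>At \<open>z = 0\<close> the identity for the gate may fail, as both squares
      vanish for \<open>relu_gate\<close>. The bias \<open>b\<close> occurs in no weight term, so it
      almost surely avoids the one value that makes \<open>z\<close> zero.\<close>
    have "AE \<theta> in \<P>. \<theta> b \<noteq> - (\<Sum>j<m. \<theta> (wt j) * h j)"
      using wt by (intro AE_coordinate_neq) (auto intro!: sum.cong)
    then show "AE \<theta> in \<P>. (\<phi> (z \<theta>))\<^sup>2 * ?Y \<theta> + (\<phi> (- z \<theta>))\<^sup>2 * ?Y \<theta> = 2 * c * ?Y \<theta>"
    proof eventually_elim
      case (elim \<theta>)
      then have "z \<theta> \<noteq> 0" by (simp add: z_def)
      then show ?case using \<phi>(2) by (simp flip: distrib_right)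
    qed
  qed measurable
  also have "\<dots> = 2 * (c * s * ?S)"
    using Y by (simp add: has_bochner_integral_iff)
  finally have "(\<integral>\<theta>. (\<phi> (z \<theta>))\<^sup>2 * ?Y \<theta> \<partial>\<P>) = c * s * ?S" by simp
  then have "has_bochner_integral \<P> (\<lambda>\<theta>. (\<phi> (z \<theta>))\<^sup>2 * ?Y \<theta>) (c * s * ?S)"
    using int[of z] by (simp add: has_bochner_integral_iff)
  then show ?thesis by (simp add: power2_eq_square mult_ac)
qed

lemma layer_det_gram:
  fixes b :: "nat \<Rightarrow> 'k" and wt :: "nat \<Rightarrow> nat \<Rightarrow> 'k" and h :: "nat \<Rightarrow> real"
    and u :: "nat \<Rightarrow> 'd::finite \<Rightarrow> real"
  assumes wt: "\<And>i. i < n \<Longrightarrow> inj_on (wt i) {..<m}" "\<And>i. i < n \<Longrightarrow> wt i ` {..<m} \<subseteq> I"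
      "\<And>i. i < n \<Longrightarrow> b i \<notin> wt i ` {..<m}" "\<And>i. i < n \<Longrightarrow> b i \<in> I"
    and disj: "disjoint_family_on (\<lambda>i. insert (b i) (wt i ` {..<m})) {..<n}"
    and s: "\<And>i j. i < n \<Longrightarrow> j < m \<Longrightarrow> v (wt i j) = s"
    and [measurable]: "\<phi> \<in> borel_measurable borel"
    and \<phi>: "\<And>t. \<bar>\<phi> t\<bar> \<le> 1" "\<And>t. t \<noteq> 0 \<Longrightarrow> (\<phi> t)\<^sup>2 + (\<phi> (- t))\<^sup>2 = 2 * c"
  defines "Y \<equiv> \<lambda>i a \<theta>. \<phi> ((\<Sum>j<m. \<theta> (wt i j) * h j) + \<theta> (b i)) * (\<Sum>j<m. \<theta> (wt i j) * u j a)"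
  shows "has_bochner_integral \<P> (\<lambda>\<theta>. det (\<chi> a a'. \<Sum>i<n. Y i a \<theta> * Y i a' \<theta>))
    ((\<Prod>j<CARD('d). real n - real j) * (c * s) ^ CARD('d) * det (\<chi> a a'. \<Sum>j<m. u j a * u j a'))"
proof -
  define K where "K i = insert (b i) (wt i ` {..<m})" for i
  have "has_bochner_integral \<P> (\<lambda>\<theta>. \<Prod>a\<in>UNIV. Y (f a) a \<theta> * Y (f a) (p a) \<theta>)
          (\<Prod>a\<in>UNIV. c * s * (\<Sum>j<m. u j a * u j (p a)))"
    if f: "f \<in> UNIV \<rightarrow>\<^sub>E {..<n}" "inj f" for f :: "'d \<Rightarrow> nat" and p
  proof -
    have fn: "f a < n" for a using f by auto
    have row: "has_bochner_integral \<P> (\<lambda>\<theta>. Y (f a) a \<theta> * Y (f a) (p a) \<theta>) (c * s * (\<Sum>j<m. u j a * u j (p a)))" for a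
      unfolding Y_def using fn[of a] by (intro row_second_moment wt s \<phi>) auto
    \<comment> \<open>Independence holds for restrictions of the parameter vector to the disjoint
      blocks \<open>K\<close>. It passes to the rows because \<open>Y i\<close> reads its arguments
      only inside \<open>K i\<close>.\<close>
    have "P.indep_vars (\<lambda>a. PiM (K (f a)) (\<lambda>_. borel)) (\<lambda>a \<theta>. restrict \<theta> (K (f a))) UNIV"
    proof (rule P.indep_vars_restrict[OF indep_coordinates])
      show "K (f a) \<subseteq> I" for a using wt[OF fn] by (auto simp: K_def)
      show "disjoint_family_on (\<lambda>a. K (f a)) UNIV"
        unfolding disjoint_family_on_def
      proof (intro ballI impI)
        fix a a' :: 'd assume "a \<noteq> a'"
        then have "f a \<noteq> f a'" using f(2) by (auto dest: injD)
        then show "K (f a) \<inter> K (f a') = {}"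
          using disjoint_family_onD[OF disj, of "f a" "f a'"] fn unfolding K_def by simp
      qed
    qed
    then have "P.indep_vars (\<lambda>_. borel)
        (\<lambda>a \<theta>. Y (f a) a (restrict \<theta> (K (f a))) * Y (f a) (p a) (restrict \<theta> (K (f a)))) UNIV"
    proof (rule P.indep_vars_compose2)
      fix a
      have [measurable]: "(\<lambda>\<theta>. \<theta> k :: real) \<in> borel_measurable (PiM (K (f a)) (\<lambda>_. borel))" for k
        using measurable_coordinate[of k "K (f a)"]
        unfolding measurable_cong_sets[OF sets_P[of "K (f a)"] refl] .
      show "(\<lambda>\<theta>. Y (f a) a \<theta> * Y (f a) (p a) \<theta>) \<in> borel_measurable (PiM (K (f a)) (\<lambda>_. borel))"
        unfolding Y_def by measurable
    qed
    moreover have "Y i a (restrict \<theta> (K i)) = Y i a \<theta>" for i a \<theta>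
      by (simp add: Y_def K_def)
    ultimately have ind: "P.indep_vars (\<lambda>_. borel) (\<lambda>a \<theta>. Y (f a) a \<theta> * Y (f a) (p a) \<theta>) UNIV"
      by simp
    show ?thesis
      using P.indep_vars_integrable[OF _ ind] P.indep_vars_lebesgue_integral[OF _ ind] row
      by (simp add: has_bochner_integral_iff)
  qed
  from has_bochner_integral_det_gram[of "{..<n}" \<P> Y "\<lambda>a a'. c * s * (\<Sum>j<m. u j a * u j a')", OF finite_lessThan this]
  have "has_bochner_integral \<P> (\<lambda>\<theta>. det (\<chi> a a'. \<Sum>i<n. Y i a \<theta> * Y i a' \<theta>))
    ((\<Prod>j<CARD('d). real n - real j) * det (\<chi> a a'. c * s * (\<Sum>j<m. u j a * u j a')))" by simp
  moreover have "det (\<chi> a a'. c * s * (\<Sum>j<m. u j a * u j a'))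
      = (c * s) ^ CARD('d) * det (\<chi> a a'. \<Sum>j<m. u j a * u j a')"
    using det_rows_mul[of "\<lambda>_. c * s" "\<lambda>a. \<chi> a'. \<Sum>j<m. u j a * u j a'"]
    by (simp add: vector_scalar_mult_def)
  ultimately show ?thesis by (simp add: mult_ac)
qed

end

section \<open>The network and its formal derivative\<close>

lemma bij_coord_idx: "bij_betw (coord_idx :: 'a::finite \<Rightarrow> nat) UNIV {..<CARD('a)}"
proof -
  have "\<exists>f :: 'a \<Rightarrow> nat. bij_betw f UNIV {..<CARD('a)}"
    using ex_bij_betw_finite_nat[of "UNIV :: 'a set"] by (simp add: atLeast0LessThan)
  then show ?thesis unfolding coord_idx_def by (rule someI_ex)
qed

lemma sum_coord_idx: "(\<Sum>k\<in>UNIV. f (coord_idx (k :: 'a::finite))) = (\<Sum>i<CARD('a). f i)"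
  by (rule sum.reindex_bij_betw[OF bij_coord_idx])

lemma sum_inv_coord_idx:
  "(\<Sum>i<CARD('a). f (inv_into UNIV coord_idx i)) = (\<Sum>k\<in>UNIV. f (k :: 'a::finite))"
  by (rule sum.reindex_bij_betw[OF bij_betw_inv_into[OF bij_coord_idx], of f])

text \<open>The index names the layer below: \<open>pre_act w th l\<close> is z^(l+1), computed from
  the activations of layer \<open>l\<close>.\<close>

definition pre_act :: "(nat \<Rightarrow> nat) \<Rightarrow> (pidx \<Rightarrow> real) \<Rightarrow> nat \<Rightarrow> real^'n \<Rightarrow> nat \<Rightarrow> real" where
  "pre_act w th l x i = (\<Sum>j<w l. th (Wt (Suc l) i j) * act w th l x j) + th (Bs (Suc l) i)"

definition relu_gate :: "real \<Rightarrow> real" where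
  "relu_gate t = (if 0 < t then 1 else 0)"

text \<open>The chain rule written down formally. Unlike the true derivative it is given by an
  explicit formula at every point, so joint measurability in parameters, point and direction can be
  read off.\<close>

primrec dact :: "(nat \<Rightarrow> nat) \<Rightarrow> (pidx \<Rightarrow> real) \<Rightarrow> nat \<Rightarrow> real^'n \<Rightarrow> real^'n \<Rightarrow> nat \<Rightarrow> real" where
  "dact w th 0 x v = (\<lambda>j. v $ inv_into UNIV coord_idx j)"
| "dact w th (Suc l) x v =
     (\<lambda>i. relu_gate (pre_act w th l x i) * (\<Sum>j<w l. th (Wt (Suc l) i j) * dact w th l x v j))"

definition dnet :: "(nat \<Rightarrow> nat) \<Rightarrow> nat \<Rightarrow> (pidx \<Rightarrow> real) \<Rightarrow> real^'n \<Rightarrow> real^'n \<Rightarrow> real^'m" where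
  "dnet w L th x v = (\<chi> k. \<Sum>j<w (L - 1). th (Wt L (coord_idx k) j) * dact w th (L - 1) x v j)"

lemma act_Suc: "act w th (Suc l) x i = max (pre_act w th l x i) 0"
  by (simp add: pre_act_def)

lemma relu_gate_measurable: "relu_gate \<in> borel_measurable borel"
  unfolding relu_gate_def by measurable

definition layer_params :: "(nat \<Rightarrow> nat) \<Rightarrow> nat \<Rightarrow> pidx set" where
  "layer_params w l = {Wt (Suc l) i j | i j. i < w (Suc l) \<and> j < w l} \<union> {Bs (Suc l) i | i. i < w (Suc l)}"

lemma param_set_0 [simp]: "param_set w 0 = {}"
  by (auto simp: param_set_def)

lemma param_set_Suc: "param_set w (Suc l) = param_set w l \<union> layer_params w l"
  by (auto simp: param_set_def layer_params_def le_Suc_eq)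

lemma param_set_layer_disjoint: "param_set w l \<inter> layer_params w l = {}"
  by (auto simp: param_set_def layer_params_def)

lemma finite_layer_params: "finite (layer_params w l)"
proof -
  have "layer_params w l \<subseteq> (\<lambda>(i, j). Wt (Suc l) i j) ` ({..<w (Suc l)} \<times> {..<w l})
      \<union> Bs (Suc l) ` {..<w (Suc l)}"
    by (auto simp: layer_params_def)
  then show ?thesis by (rule finite_subset) auto
qed

lemma finite_param_set: "finite (param_set w l)"
  by (induction l) (auto simp: param_set_Suc finite_layer_params)

text \<open>Layer \<open>l\<close> sees only the parameters up to its own level. It is therefore
  constant while the next layer is integrated out, and while a bias of the next layer
  varies.\<close>

lemma act_cong:
  assumes "\<And>k. k \<in> param_set w l \<Longrightarrow> th k = th' k" "i < w l"
  shows "act w th l x i = act w th' l x i"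
  using assms
proof (induction l arbitrary: i)
  case (Suc l)
  have "th (Wt (Suc l) i j) = th' (Wt (Suc l) i j)" if "j < w l" for j
    using Suc.prems that by (auto simp: param_set_def)
  moreover have "th (Bs (Suc l) i) = th' (Bs (Suc l) i)"
    using Suc.prems by (auto simp: param_set_def)
  moreover have "act w th l x j = act w th' l x j" if "j < w l" for j
    using Suc.prems that by (intro Suc.IH) (auto simp: param_set_Suc)
  ultimately show ?case by simp
qed simp

lemma dact_cong:
  assumes "\<And>k. k \<in> param_set w l \<Longrightarrow> th k = th' k" "i < w l"
  shows "dact w th l x v i = dact w th' l x v i"
  using assms
proof (induction l arbitrary: i)
  case (Suc l)
  have th: "th (Wt (Suc l) i j) = th' (Wt (Suc l) i j)" if "j < w l" for j
    using Suc.prems that by (auto simp: param_set_def)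
  have "th (Bs (Suc l) i) = th' (Bs (Suc l) i)"
    using Suc.prems by (auto simp: param_set_def)
  moreover have "act w th l x j = act w th' l x j" if "j < w l" for j
    using Suc.prems that by (intro act_cong) (auto simp: param_set_Suc)
  ultimately have "pre_act w th l x i = pre_act w th' l x i"
    using th by (simp add: pre_act_def)
  moreover have "dact w th l x v j = dact w th' l x v j" if "j < w l" for j
    using Suc.prems that by (intro Suc.IH) (auto simp: param_set_Suc)
  ultimately show ?case using th by simp
qed simp

text \<open>A nonzero preactivation keeps its sign near \<open>x\<close> by continuity, so the ReLU
  acts there as the identity or as zero, in agreement with the gate.\<close>

lemma has_derivative_act:
  fixes x :: "real^'n"
  assumes "\<And>l' i. l' < l \<Longrightarrow> i < w (Suc l') \<Longrightarrow> pre_act w th l' x i \<noteq> 0" "i < w l"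
  shows "((\<lambda>x. act w th l x i) has_derivative (\<lambda>v. dact w th l x v i)) (at x)"
  using assms
proof (induction l arbitrary: i)
  case 0
  show ?case by (simp add: bounded_linear_vec_nth bounded_linear_imp_has_derivative)
next
  case (Suc l)
  let ?z = "\<lambda>x. pre_act w th l x i"
  let ?dz = "\<lambda>v. \<Sum>j<w l. th (Wt (Suc l) i j) * dact w th l x v j"
  have dz: "(?z has_derivative ?dz) (at x)"
    unfolding pre_act_def using Suc.prems
    by (auto intro!: derivative_eq_intros Suc.IH)
  have cont: "(?z \<longlongrightarrow> ?z x) (at x)"
    using has_derivative_continuous[OF dz] by (simp add: continuous_at)
  have nz: "?z x \<noteq> 0" using Suc.prems by auto
  show ?case
  proof (cases "0 < ?z x")
    case True
    have ev: "\<forall>\<^sub>F y in at x. ?z y = act w th (Suc l) y i"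
      using order_tendstoD(1)[OF cont True] by eventually_elim (simp add: act_Suc del: act.simps)
    have "((\<lambda>x. act w th (Suc l) x i) has_derivative ?dz) (at x)"
      using dz ev by (rule has_derivative_transform_eventually) (use True in \<open>auto simp: act_Suc simp del: act.simps\<close>)
    then show ?thesis using True by (simp add: relu_gate_def del: act.simps)
  next
    case False
    then have neg: "?z x < 0" using nz by simp
    have ev: "\<forall>\<^sub>F y in at x. 0 = act w th (Suc l) y i"
      using order_tendstoD(2)[OF cont neg] by eventually_elim (simp add: act_Suc del: act.simps)
    have "((\<lambda>x. act w th (Suc l) x i) has_derivative (\<lambda>v. 0)) (at x)"
      using has_derivative_const ev by (rule has_derivative_transform_eventually) (use neg in \<open>auto simp: act_Suc simp del: act.simps\<close>)
    then show ?thesis using False by (simp add: relu_gate_def del: act.simps)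
  qed
qed

lemma has_derivative_net:
  fixes x :: "real^'n"
  assumes "\<And>l i. Suc l < L \<Longrightarrow> i < w (Suc l) \<Longrightarrow> pre_act w th l x i \<noteq> 0"
  shows "((net w L th :: real^'n \<Rightarrow> real^'m) has_derivative dnet w L th x) (at x)"
proof -
  have act: "((\<lambda>x. act w th (L - 1) x j) has_derivative (\<lambda>v. dact w th (L - 1) x v j)) (at x)"
    if "j < w (L - 1)" for j
    using that assms by (intro has_derivative_act) (auto simp: less_diff_conv)
  have "((\<lambda>x. net w L th x $ k) has_derivative (\<lambda>v. dnet w L th x v $ k)) (at x)" for k :: 'm
    unfolding net_def dnet_def vec_lambda_beta
    by (intro has_derivative_add_const has_derivative_sum has_derivative_mult_right act) simp
  then show ?thesis
    by (subst has_derivative_componentwise_within)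
      (auto simp: Basis_vec_def inner_axis)
qed

text \<open>Point and parameters are both functions of an abstract argument. With \<open>X\<close>
  constant this gives measurability in the parameters at a fixed point, with projections the joint
  measurability that Tonelli asks for.\<close>

lemma measurable_act:
  fixes X :: "'a \<Rightarrow> real^'n"
  assumes X: "X \<in> borel_measurable M" and T: "\<And>k. (\<lambda>\<omega>. T \<omega> k) \<in> borel_measurable M"
  shows "(\<lambda>\<omega>. act w (T \<omega>) l (X \<omega>) j) \<in> borel_measurable M"
proof (induction l arbitrary: j)
  case 0
  show ?case using measurable_compose[OF X borel_measurable_nth] by simp
next
  case (Suc l)
  show ?case unfolding act.simps
    by (intro borel_measurable_max borel_measurable_add borel_measurable_sum borel_measurable_times
        borel_measurable_const T Suc.IH)
qed

lemma measurable_pre_act: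
  fixes X :: "'a \<Rightarrow> real^'n"
  assumes X: "X \<in> borel_measurable M" and T: "\<And>k. (\<lambda>\<omega>. T \<omega> k) \<in> borel_measurable M"
  shows "(\<lambda>\<omega>. pre_act w (T \<omega>) l (X \<omega>) j) \<in> borel_measurable M"
  unfolding pre_act_def
  by (intro borel_measurable_add borel_measurable_sum borel_measurable_times T measurable_act[OF X T])

lemma measurable_dact:
  fixes X E :: "'a \<Rightarrow> real^'n"
  assumes X: "X \<in> borel_measurable M" and E: "E \<in> borel_measurable M"
    and T: "\<And>k. (\<lambda>\<omega>. T \<omega> k) \<in> borel_measurable M"
  shows "(\<lambda>\<omega>. dact w (T \<omega>) l (X \<omega>) (E \<omega>) j) \<in> borel_measurable M"
proof (induction l arbitrary: j)
  case 0
  show ?case using measurable_compose[OF E borel_measurable_nth] by simp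
next
  case (Suc l)
  show ?case unfolding dact.simps
    by (intro borel_measurable_sum borel_measurable_times T Suc.IH
        measurable_compose[OF measurable_pre_act[OF X T] relu_gate_measurable])
qed

lemma borel_measurable_det_sum_products:
  fixes Y :: "'i \<Rightarrow> 'd::finite \<Rightarrow> 'w \<Rightarrow> real"
  assumes "\<And>i a. i \<in> S \<Longrightarrow> Y i a \<in> borel_measurable M"
  shows "(\<lambda>\<omega>. det (\<chi> a b. \<Sum>i\<in>S. Y i a \<omega> * Y i b \<omega>)) \<in> borel_measurable M"
  unfolding det_def vec_lambda_beta
  by (intro borel_measurable_sum borel_measurable_times borel_measurable_prod borel_measurable_const assms)

text \<open>One layer of the recursion; the gate \<open>\<phi>\<close> is the ReLU gate for hidden layers and
  constantly 1 for the output layer.\<close>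
lemma nn_integral_layer:
  fixes x :: "real^'n" and e :: "'d::finite \<Rightarrow> real^'n"
  assumes v_pos: "\<And>k. 0 < v k"
    and v: "\<And>i j. i < w (Suc l) \<Longrightarrow> j < w l \<Longrightarrow> v (Wt (Suc l) i j) = s"
    and \<phi>_meas: "\<phi> \<in> borel_measurable borel"
    and \<phi>: "\<And>t. \<bar>\<phi> t\<bar> \<le> 1" "\<And>t. t \<noteq> 0 \<Longrightarrow> (\<phi> t)\<^sup>2 + (\<phi> (- t))\<^sup>2 = 2 * c"
    and cs: "0 \<le> c * s"
  defines "Y \<equiv> \<lambda>i a \<theta>. \<phi> (pre_act w \<theta> l x i) * (\<Sum>j<w l. \<theta> (Wt (Suc l) i j) * dact w \<theta> l x (e a) j)"
  defines "F \<equiv> \<Prod>j<CARD('d). real (w (Suc l)) - real j"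
  assumes F: "0 \<le> F"
  shows "(\<integral>\<^sup>+\<theta>. ennreal (det (\<chi> a b. \<Sum>i<w (Suc l). Y i a \<theta> * Y i b \<theta>))
            \<partial>PiM (param_set w (Suc l)) (\<lambda>k. centered_normal (v k)))
    = ennreal (F * (c * s) ^ CARD('d)) *
      (\<integral>\<^sup>+\<theta>. ennreal (det (\<chi> a b. \<Sum>i<w l. dact w \<theta> l x (e a) i * dact w \<theta> l x (e b) i))
            \<partial>PiM (param_set w l) (\<lambda>k. centered_normal (v k)))"
proof -
  interpret L: gaussian_family v "layer_params w l"
    using v_pos finite_layer_params by unfold_locales
  let ?N = "\<lambda>k. centered_normal (v k)"
  let ?P = "param_set w l" and ?K = "layer_params w l"
  let ?G = "\<lambda>\<theta>. det (\<chi> a b. \<Sum>i<w l. dact w \<theta> l x (e a) i * dact w \<theta> l x (e b) i)"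
  let ?D = "\<lambda>\<theta>. det (\<chi> a b. \<Sum>i<w (Suc l). Y i a \<theta> * Y i b \<theta>)"
  have X: "(\<lambda>_. x) \<in> borel_measurable M" for M :: "(pidx \<Rightarrow> real) measure" by simp
  have E: "(\<lambda>_. e a) \<in> borel_measurable M" for a and M :: "(pidx \<Rightarrow> real) measure" by simp
  have "(\<lambda>\<theta>. Y i a \<theta>) \<in> borel_measurable (PiM (?P \<union> ?K) ?N)" for i a
    unfolding Y_def
    by (intro borel_measurable_sum borel_measurable_times L.measurable_coordinate
        measurable_compose[OF measurable_pre_act[OF X L.measurable_coordinate] \<phi>_meas]
        measurable_dact[OF X E L.measurable_coordinate])
  then have Dm: "?D \<in> borel_measurable (PiM (?P \<union> ?K) ?N)"
    by (intro borel_measurable_det_sum_products)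
  have Gm: "?G \<in> borel_measurable (PiM ?P ?N)"
    by (intro borel_measurable_det_sum_products measurable_dact[OF X E L.measurable_coordinate])
  have "(\<integral>\<^sup>+\<theta>. ennreal (?D \<theta>) \<partial>PiM (param_set w (Suc l)) ?N)
      = (\<integral>\<^sup>+\<theta>. (\<integral>\<^sup>+\<eta>. ennreal (?D (merge ?P ?K (\<theta>, \<eta>))) \<partial>PiM ?K ?N) \<partial>PiM ?P ?N)"
    unfolding param_set_Suc using Dm
    by (intro L.product_nn_integral_fold param_set_layer_disjoint finite_param_set finite_layer_params
        measurable_compose[OF Dm]) auto
  also have "\<dots> = (\<integral>\<^sup>+\<theta>. ennreal (F * (c * s) ^ CARD('d)) * ennreal (?G \<theta>) \<partial>PiM ?P ?N)"
  proof (intro nn_integral_cong)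
    fix \<theta>
    \<comment> \<open>With the earlier parameters \<open>\<theta>\<close> fixed, the layers below
      are constants \<open>h\<close> and \<open>u\<close>; what remains random is exactly the
      setting of \<open>layer_det_gram\<close>.\<close>
    define h where "h j = act w \<theta> l x j" for j
    define u where "u j a = dact w \<theta> l x (e a) j" for j a
    define Z where "Z i a \<eta> = \<phi> ((\<Sum>j<w l. \<eta> (Wt (Suc l) i j) * h j) + \<eta> (Bs (Suc l) i))
        * (\<Sum>j<w l. \<eta> (Wt (Suc l) i j) * u j a)" for i a \<eta>
    have Y: "Y i a (merge ?P ?K (\<theta>, \<eta>)) = Z i a \<eta>" if "i < w (Suc l)" for i a \<eta>
    proof -
      let ?m = "merge ?P ?K (\<theta>, \<eta>)"
      have W: "?m (Wt (Suc l) i j) = \<eta> (Wt (Suc l) i j)" if "j < w l" for j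
        using \<open>i < w (Suc l)\<close> that by (auto simp: merge_def layer_params_def param_set_def)
      have B: "?m (Bs (Suc l) i) = \<eta> (Bs (Suc l) i)"
        using \<open>i < w (Suc l)\<close> by (auto simp: merge_def layer_params_def param_set_def)
      have "act w ?m l x j = h j" if "j < w l" for j
        unfolding h_def using that by (intro act_cong) (auto simp: merge_def)
      moreover have "dact w ?m l x (e a) j = u j a" if "j < w l" for j
        unfolding u_def using that by (intro dact_cong) (auto simp: merge_def)
      ultimately show ?thesis using W B by (simp add: Y_def Z_def pre_act_def)
    qed
    have "has_bochner_integral (PiM ?K ?N) (\<lambda>\<eta>. det (\<chi> a b. \<Sum>i<w (Suc l). Z i a \<eta> * Z i b \<eta>))
      (F * (c * s) ^ CARD('d) * det (\<chi> a b. \<Sum>j<w l. u j a * u j b))"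
      unfolding Z_def F_def
    proof (rule L.layer_det_gram)
      show "disjoint_family_on (\<lambda>i. insert (Bs (Suc l) i) (Wt (Suc l) i ` {..<w l})) {..<w (Suc l)}"
        by (auto simp: disjoint_family_on_def)
    qed (auto simp: layer_params_def inj_on_def v \<phi>_meas \<phi>)
    \<comment> \<open>Gram determinants are nonnegative, so the Bochner moment is also a nonnegative
      integral, a form that can be iterated over the layers.\<close>
    then have "(\<integral>\<^sup>+\<eta>. ennreal (det (\<chi> a b. \<Sum>i<w (Suc l). Z i a \<eta> * Z i b \<eta>)) \<partial>PiM ?K ?N)
       = ennreal (F * (c * s) ^ CARD('d) * ?G \<theta>)"
      unfolding u_def
      by (subst nn_integral_eq_integral) (auto simp: has_bochner_integral_iff det_gram_nonneg)
    also have "\<dots> = ennreal (F * (c * s) ^ CARD('d)) * ennreal (?G \<theta>)"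
      using F cs by (intro ennreal_mult) (auto simp: det_gram_nonneg)
    finally show "(\<integral>\<^sup>+\<eta>. ennreal (?D (merge ?P ?K (\<theta>, \<eta>))) \<partial>PiM ?K ?N)
       = ennreal (F * (c * s) ^ CARD('d)) * ennreal (?G \<theta>)"
      by (simp add: Y)
  qed
  also have "\<dots> = ennreal (F * (c * s) ^ CARD('d)) * (\<integral>\<^sup>+\<theta>. ennreal (?G \<theta>) \<partial>PiM ?P ?N)"
    using Gm by (intro nn_integral_cmult) auto
  finally show ?thesis .
qed

section \<open>Expected Gram determinant of the whole network at a fixed point\<close>

lemma param_measure_eq_PiM:
  assumes "\<And>k. k \<in> param_set w L \<Longrightarrow> v k = param_var w L Cb k"
  shows "param_measure w L Cb = PiM (param_set w L) (\<lambda>k. centered_normal (v k))"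
  unfolding param_measure_def centered_normal_def using assms by (intro PiM_cong) auto

lemma falling_factorial_nonneg:
  assumes "d \<le> n"
  shows "0 \<le> (\<Prod>j<d. real n - real j)"
  using assms by (intro prod_nonneg) auto

text \<open>By \<open>falling_factorial_le\<close>, passing from width \<open>w l\<close> to
  \<open>w (Suc l)\<close> costs at most the d-th power of their quotient times one exponential
  factor; the quotients telescope. The Gram determinant of \<open>e\<close> stays as the initial
  value, since the frames taken from charts are not orthonormal.\<close>

lemma nn_integral_det_dnet_le:
  fixes w :: "nat \<Rightarrow> nat" and x :: "real^'n" and e :: "'d::finite \<Rightarrow> real^'n"
  assumes L: "1 \<le> L" and w: "\<And>l. l \<le> L \<Longrightarrow> 1 \<le> w l"
    and w0: "w 0 = CARD('n)" and wL: "w L = CARD('m)"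
    and d: "\<And>l. l \<le> L \<Longrightarrow> CARD('d) \<le> w l"
    and v_pos: "\<And>k. 0 < v k"
    and v: "\<And>k. k \<in> param_set w L \<Longrightarrow> v k = param_var w L Cb k"
  shows "(\<integral>\<^sup>+\<theta>. ennreal (det (\<chi> a b. (dnet w L \<theta> x (e a) :: real^'m) \<bullet> dnet w L \<theta> x (e b)))
            \<partial>PiM (param_set w L) (\<lambda>k. centered_normal (v k)))
    \<le> ennreal ((real CARD('m) / real CARD('n)) ^ CARD('d)
             * exp (- real (CARD('d) choose 2) * (\<Sum>l=1..L. 1 / real (w l))) * det (\<chi> a b. e a \<bullet> e b))"
proof -
  let ?N = "\<lambda>k. centered_normal (v k)"
  define C where "C = real (CARD('d) choose 2)"
  define G0 where "G0 = det (\<chi> a b. e a \<bullet> e b)"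
  define bnd where "bnd l = (real (w l) / real (w 0)) ^ CARD('d) * exp (- C * (\<Sum>k=1..l. 1 / real (w k))) * G0" for l
  define F where "F l = (\<Prod>j<CARD('d). real (w (Suc l)) - real j)" for l
  define G where "G l \<theta> = det (\<chi> a b. \<Sum>i<w l. dact w \<theta> l x (e a) i * dact w \<theta> l x (e b) i)" for l \<theta>
  have G_0: "G 0 \<theta> = G0" for \<theta>
  proof -
    have "(\<Sum>i<w 0. dact w \<theta> 0 x (e a) i * dact w \<theta> 0 x (e b) i) = e a \<bullet> e b" for a b
      using sum_inv_coord_idx[of "\<lambda>k. e a $ k * e b $ k"] by (simp add: w0 inner_vec_def)
    then show ?thesis by (simp add: G_def G0_def)
  qed
  \<comment> \<open>\<open>G 0\<close> ignores the parameters, so any choice of them exhibits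
    \<open>G0\<close> as a Gram determinant in the form required by
    \<open>det_gram_nonneg\<close>.\<close>
  have "0 \<le> G 0 (\<lambda>_. 0)" unfolding G_def by (rule det_gram_nonneg) simp
  then have "0 \<le> G0" by (simp add: G_0)
  have F: "0 \<le> F l" if "l < L" for l
    using d[of "Suc l"] that unfolding F_def by (intro falling_factorial_nonneg) simp
  have bnd0: "0 \<le> bnd l" for l using \<open>0 \<le> G0\<close> by (simp add: bnd_def)
  have step: "F l * (1 / real (w l)) ^ CARD('d) * bnd l \<le> bnd (Suc l)" if "l < L" for l
  proof -
    let ?w = "real (w l)" and ?w' = "real (w (Suc l))"
    have pos: "0 < ?w" using w[of l] that by simp
    have "F l \<le> ?w' ^ CARD('d) * exp (- C * (1 / ?w'))"
      unfolding F_def C_def using that d[of "Suc l"] w[of "Suc l"] by (intro falling_factorial_le) auto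
    then have "F l * ((1 / ?w) ^ CARD('d) * bnd l)
        \<le> (?w' ^ CARD('d) * exp (- C * (1 / ?w'))) * ((1 / ?w) ^ CARD('d) * bnd l)"
      using bnd0 pos by (intro mult_right_mono) auto
    also have "\<dots> = bnd (Suc l)"
    proof -
      have e1: "exp (- C * (\<Sum>k=1..Suc l. 1 / real (w k)))
          = exp (- C * (\<Sum>k=1..l. 1 / real (w k))) * exp (- C * (1 / ?w'))"
        by (simp add: distrib_left flip: exp_add)
      have e2: "?w' ^ CARD('d) * ((1 / ?w) ^ CARD('d) * (?w / real (w 0)) ^ CARD('d))
          = (?w' / real (w 0)) ^ CARD('d)"
        using pos by (simp flip: power_mult_distrib)
      show ?thesis unfolding bnd_def e1 e2[symmetric] by (simp only: mult_ac)
    qed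
    finally show ?thesis by (simp add: mult_ac)
  qed
  have v_Wt: "v (Wt (Suc l) i j) = (if Suc l < L then 2 / real (w l) else 1 / real (w l))"
    if "l < L" "i < w (Suc l)" "j < w l" for l i j
    using that by (subst v) (auto simp: param_set_def)
  have hidden: "(\<integral>\<^sup>+\<theta>. ennreal (G l \<theta>) \<partial>PiM (param_set w l) ?N) \<le> ennreal (bnd l)" if "l < L" for l
    using that
  proof (induction l)
    case 0
    have "bnd 0 = G0" using w[of 0] by (simp add: bnd_def)
    moreover have "emeasure (PiM {} ?N) (space (PiM {} ?N)) = 1"
      by (simp add: PiM_empty)
    ultimately show ?case by (simp only: G_0 nn_integral_const param_set_0) simp
  next
    case (Suc l)
    \<comment> \<open>Hidden layer: the gate gives \<open>c = 1/2\<close> and the variance is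
      \<open>s = 2 / w l\<close>, so that \<open>c * s = 1 / w l\<close>.\<close>
    have "(\<integral>\<^sup>+\<theta>. ennreal (G (Suc l) \<theta>) \<partial>PiM (param_set w (Suc l)) ?N)
      = ennreal (F l * (1 / 2 * (2 / real (w l))) ^ CARD('d)) * (\<integral>\<^sup>+\<theta>. ennreal (G l \<theta>) \<partial>PiM (param_set w l) ?N)"
      unfolding G_def dact.simps F_def using Suc.prems v_Wt[of l] F[of l]
      by (intro nn_integral_layer v_pos relu_gate_measurable) (auto simp: relu_gate_def F_def)
    also have "\<dots> \<le> ennreal (F l * (1 / 2 * (2 / real (w l))) ^ CARD('d)) * ennreal (bnd l)"
      using Suc by (intro mult_left_mono) auto
    also have "\<dots> = ennreal (F l * (1 / real (w l)) ^ CARD('d) * bnd l)"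
      using Suc.prems F[of l] bnd0 by (subst ennreal_mult) auto
    also have "\<dots> \<le> ennreal (bnd (Suc l))"
      using Suc.prems step by (intro ennreal_leI) auto
    finally show ?case .
  qed
  obtain K where K: "L = Suc K" using L by (cases L) auto
  have out: "(dnet w L \<theta> x (e a) :: real^'m) \<bullet> dnet w L \<theta> x (e b)
     = (\<Sum>i<w (Suc K). (1 * (\<Sum>j<w K. \<theta> (Wt (Suc K) i j) * dact w \<theta> K x (e a) j))
          * (1 * (\<Sum>j<w K. \<theta> (Wt (Suc K) i j) * dact w \<theta> K x (e b) j)))" for \<theta> a b
    using sum_coord_idx[where 'a = 'm, of "\<lambda>i. (\<Sum>j<w K. \<theta> (Wt (Suc K) i j) * dact w \<theta> K x (e a) j)
        * (\<Sum>j<w K. \<theta> (Wt (Suc K) i j) * dact w \<theta> K x (e b) j)"] wL K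
    by (simp add: inner_vec_def dnet_def)
  \<comment> \<open>Output layer: the gate is constantly 1, so \<open>c = 1\<close>, and the
    variance \<open>s = 1 / w K\<close> yields the same kind of factor as a hidden layer.\<close>
  have "(\<integral>\<^sup>+\<theta>. ennreal (det (\<chi> a b. (dnet w L \<theta> x (e a) :: real^'m) \<bullet> dnet w L \<theta> x (e b)))
            \<partial>PiM (param_set w L) ?N)
    = ennreal (F K * (1 * (1 / real (w K))) ^ CARD('d)) * (\<integral>\<^sup>+\<theta>. ennreal (G K \<theta>) \<partial>PiM (param_set w K) ?N)"
    unfolding out unfolding K G_def F_def using v_Wt[of K] F[of K] K
    by (intro nn_integral_layer[where \<phi> = "\<lambda>_. 1"] v_pos) (auto simp: F_def)
  also have "\<dots> \<le> ennreal (F K * (1 * (1 / real (w K))) ^ CARD('d)) * ennreal (bnd K)"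
    using hidden[of K] K by (intro mult_left_mono) auto
  also have "\<dots> = ennreal (F K * (1 / real (w K)) ^ CARD('d) * bnd K)"
    using K F[of K] bnd0 by (subst ennreal_mult) auto
  also have "\<dots> \<le> ennreal (bnd L)"
    using K step by (intro ennreal_leI) auto
  finally show ?thesis by (simp add: bnd_def wL w0 G0_def C_def)
qed

text \<open>The bias enters additively and the layers up to \<open>l\<close> do not see it, so the
  preactivation vanishes only if the bias hits a value determined by the other parameters.\<close>

lemma AE_pre_act_nonzero:
  fixes x :: "real^'n"
  assumes "l < L" "i < w (Suc l)" and v_pos: "\<And>k. 0 < v k"
  shows "AE \<theta> in PiM (param_set w L) (\<lambda>k. centered_normal (v k)). pre_act w \<theta> l x i \<noteq> 0"
proof -
  interpret gaussian_family v "param_set w L"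
    using v_pos finite_param_set by unfold_locales
  let ?b = "Bs (Suc l) i"
  let ?g = "\<lambda>\<theta>. - (\<Sum>j<w l. \<theta> (Wt (Suc l) i j) * act w \<theta> l x j)"
  have "AE \<theta> in \<P>. \<theta> ?b \<noteq> ?g \<theta>"
  proof (rule AE_coordinate_neq)
    show "?b \<in> param_set w L" using assms by (auto simp: param_set_def)
    show "?g \<in> borel_measurable \<P>"
      by (intro borel_measurable_uminus borel_measurable_sum borel_measurable_times
          measurable_coordinate measurable_act) simp
    show "?g (\<theta>(?b := y)) = ?g \<theta>" for \<theta> y
    proof -
      have "act w (\<theta>(?b := y)) l x j = act w \<theta> l x j" if "j < w l" for j
        using that by (intro act_cong) (auto simp: param_set_def)
      then show ?thesis by simp
    qed
  qed
  then show ?thesis by eventually_elim (auto simp: pre_act_def)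
qed

section \<open>Measurable frames of the tangent spaces\<close>

lemma smooth_on_imp:
  assumes "smooth_on V f" "x \<in> V"
  shows "(f has_derivative frechet_derivative f (at x)) (at x)"
    and "isCont (\<lambda>y. frechet_derivative f (at y) k) x"
proof -
  obtain F where F: "f \<in> F" "\<And>g x. g \<in> F \<Longrightarrow> x \<in> V \<Longrightarrow> g differentiable (at x)"
    "\<And>g v. g \<in> F \<Longrightarrow> (\<lambda>x. frechet_derivative g (at x) v) \<in> F"
    using assms(1) unfolding smooth_on_def by blast
  show "(f has_derivative frechet_derivative f (at x)) (at x)"
    using F(1,2) assms(2) by (simp flip: frechet_derivative_works)
  have "(\<lambda>y. frechet_derivative f (at y) k) differentiable (at x)"
    using F assms(2) by blast
  then show "isCont (\<lambda>y. frechet_derivative f (at y) k) x"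
    by (rule differentiable_imp_continuous_within)
qed

lemma norm_divideR_le:
  fixes z :: "'a::real_normed_vector"
  assumes "norm z \<le> c * \<bar>t\<bar>" "t \<noteq> 0"
  shows "norm (z /\<^sub>R t) \<le> c"
  using assms unfolding norm_scaleR abs_inverse by (simp add: field_simps)

text \<open>Vectors in \<open>range D\<close> are velocities of images of straight lines. For the
  converse a curve in \<open>M\<close> is pulled back to \<open>u + h t\<close>, but the inverse
  chart is only continuous, so \<open>h\<close> cannot simply be differentiated. Since
  \<open>D\<close> is bounded below, the linearization of the chart still forces \<open>h t\<close>
  to be of order \<open>t\<close>; then \<open>D (h t /\<^sub>R t)\<close> comes arbitrarily close
  to \<open>v\<close>, and \<open>range D\<close> is closed.\<close>

lemma tangent_space_chart:
  fixes \<phi> :: "'d::euclidean_space \<Rightarrow> 'n::euclidean_space"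
  assumes U: "open U" and V: "open V" and img: "\<phi> ` V = M \<inter> U" and inj: "inj_on \<phi> V"
    and cont: "continuous_on (M \<inter> U) (inv_into V \<phi>)"
    and u: "u \<in> V" and D: "(\<phi> has_derivative D) (at u)" and injD: "inj D"
  shows "tangent_space M (\<phi> u) = range D"
proof (intro equalityI subsetI)
  have lin: "linear D" using D by (rule has_derivative_linear)
  fix v assume "v \<in> range D"
  then obtain k where k: "v = D k" by auto
  \<comment> \<open>\<open>tangent_space\<close> asks for a curve that stays in \<open>M\<close> at
    all times; outside \<open>V\<close> it is therefore parked at the base point.\<close>
  define \<gamma> where "\<gamma> t = (if u + t *\<^sub>R k \<in> V then \<phi> (u + t *\<^sub>R k) else \<phi> u)" for t :: real
  have "\<gamma> t \<in> M" for t using img u by (auto simp: \<gamma>_def)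
  moreover have "\<gamma> 0 = \<phi> u" by (simp add: \<gamma>_def)
  moreover have "(\<gamma> has_vector_derivative v) (at 0)"
  proof -
    have "((\<lambda>t::real. u + t *\<^sub>R k) has_derivative (\<lambda>t. t *\<^sub>R k)) (at 0)"
      by (auto intro!: derivative_eq_intros)
    moreover have "(\<phi> has_derivative D) (at (u + 0 *\<^sub>R k))" using D by simp
    ultimately have der: "((\<lambda>t. \<phi> (u + t *\<^sub>R k)) has_derivative (\<lambda>t. D (t *\<^sub>R k))) (at 0)"
      by (rule has_derivative_compose)
    have "((\<lambda>t::real. u + t *\<^sub>R k) \<longlongrightarrow> u + 0 *\<^sub>R k) (at 0)"
      by (intro tendsto_intros)
    then have "\<forall>\<^sub>F t in at 0. u + t *\<^sub>R k \<in> V"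
      using V u by (intro topological_tendstoD) auto
    then have "\<forall>\<^sub>F t in at 0. \<phi> (u + t *\<^sub>R k) = \<gamma> t"
      by eventually_elim (simp add: \<gamma>_def)
    then have "(\<gamma> has_derivative (\<lambda>t. D (t *\<^sub>R k))) (at 0)"
      using u by (intro has_derivative_transform_eventually[OF der]) (auto simp: \<gamma>_def)
    then show ?thesis
      using lin by (simp add: has_vector_derivative_def k linear_cmul)
  qed
  ultimately show "v \<in> tangent_space M (\<phi> u)" unfolding tangent_space_def by blast
next
  have lin: "linear D" using D by (rule has_derivative_linear)
  obtain B where B: "B > 0" "\<And>x. B * norm x \<le> norm (D x)"
    using linear_inj_bounded_below_pos[OF lin injD] by blast
  fix v assume "v \<in> tangent_space M (\<phi> u)"
  then obtain \<gamma> where \<gamma>: "\<gamma> 0 = \<phi> u" "\<And>t. \<gamma> t \<in> M" "(\<gamma> has_vector_derivative v) (at (0::real))"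
    unfolding tangent_space_def by blast
  have \<phi>u: "\<phi> u \<in> M \<inter> U" using u img by auto
  have c\<gamma>: "(\<gamma> \<longlongrightarrow> \<phi> u) (at 0)"
    using has_vector_derivative_continuous[OF \<gamma>(3)] \<gamma>(1) by (simp add: continuous_at)
  have evU: "\<forall>\<^sub>F t in at 0. \<gamma> t \<in> M \<inter> U"
    using topological_tendstoD[OF c\<gamma> U] \<phi>u by (auto elim: eventually_mono simp: \<gamma>(2))
  define h where "h t = inv_into V \<phi> (\<gamma> t) - u" for t
  have "((\<lambda>t. inv_into V \<phi> (\<gamma> t)) \<longlongrightarrow> inv_into V \<phi> (\<phi> u)) (at 0)"
    using cont \<phi>u c\<gamma> evU by (intro continuous_on_tendsto_compose[OF cont]) auto
  then have h0: "(h \<longlongrightarrow> 0) (at 0)"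
    unfolding h_def using inj u by (auto intro!: tendsto_eq_intros simp: inv_into_f_f)
  have \<phi>h: "\<forall>\<^sub>F t in at 0. \<phi> (u + h t) = \<gamma> t"
    using evU
  proof eventually_elim
    case (elim t)
    then have "\<gamma> t \<in> \<phi> ` V" using img by simp
    then show ?case by (simp add: h_def f_inv_into_f)
  qed
  have R: "\<forall>\<^sub>F t in at 0. norm (\<gamma> t - \<phi> u - D (h t)) \<le> e * norm (h t)" if e: "e > 0" for e
  proof -
    obtain d where d: "d > 0" "\<And>y. norm (y - u) < d \<Longrightarrow> norm (\<phi> y - \<phi> u - D (y - u)) \<le> e * norm (y - u)"
      using D[unfolded has_derivative_at_alt, THEN conjunct2, rule_format, OF e] by blast
    have "\<forall>\<^sub>F t in at 0. norm (h t) < d"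
      using tendstoD[OF h0 d(1)] by simp
    with \<phi>h show ?thesis
    proof eventually_elim
      case (elim t)
      then show ?case using d(2)[of "u + h t"] by simp
    qed
  qed
  have quot: "((\<lambda>t. (\<gamma> t - \<phi> u) /\<^sub>R t) \<longlongrightarrow> v) (at 0)"
  proof (rule tendstoI)
    fix e :: real assume "e > 0"
    then have "e / 2 > 0" by simp
    obtain d where d: "d > 0"
      "\<And>t. norm (t - 0) < d \<Longrightarrow> norm (\<gamma> t - \<gamma> 0 - (t - 0) *\<^sub>R v) \<le> e / 2 * norm (t - 0)"
      using \<gamma>(3)[unfolded has_vector_derivative_def has_derivative_at_alt, THEN conjunct2, rule_format, OF \<open>e / 2 > 0\<close>]
      by blast
    have "\<forall>\<^sub>F t in at (0::real). dist t 0 < d \<and> t \<noteq> 0"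
      using d(1) by (auto simp: eventually_at)
    then show "\<forall>\<^sub>F t in at 0. dist ((\<gamma> t - \<phi> u) /\<^sub>R t) v < e"
    proof eventually_elim
      case (elim t)
      have "dist ((\<gamma> t - \<phi> u) /\<^sub>R t) v = norm ((\<gamma> t - \<phi> u - t *\<^sub>R v) /\<^sub>R t)"
        using elim by (simp add: dist_norm scaleR_diff_right)
      also have "\<dots> \<le> e / 2"
        using d(2)[of t] elim \<gamma>(1) by (intro norm_divideR_le) simp_all
      finally show ?case using \<open>e > 0\<close> by simp
    qed
  qed
  have "v \<in> closure (range D)"
    unfolding closure_approachable
  proof (intro allI impI)
    fix e :: real assume "e > 0"
    \<comment> \<open>The bound \<open>B / 2\<close> absorbs the linearization error into the lower
      bound for \<open>D\<close> and yields norm (h t) \<le> 2/B * (norm v + 1) * |t|; inserted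
      there, the second bound makes the error at most e/4 * |t|.\<close>
    define e' where "e' = min (B / 2) (e * B / (8 * (norm v + 1)))"
    have nv: "0 < norm v + 1" by (simp add: add_nonneg_pos)
    then have e': "e' > 0" using \<open>e > 0\<close> B(1) by (simp add: e'_def)
    have ev: "\<forall>\<^sub>F t in at (0::real). norm (\<gamma> t - \<phi> u - D (h t)) \<le> e' * norm (h t) \<and>
       dist ((\<gamma> t - \<phi> u) /\<^sub>R t) v < min 1 (e / 2) \<and> t \<noteq> 0"
      using R[OF e'] tendstoD[OF quot, of "min 1 (e / 2)"] \<open>e > 0\<close>
      by (intro eventually_conj) (auto simp: eventually_at_filter)
    obtain t where t: "norm (\<gamma> t - \<phi> u - D (h t)) \<le> e' * norm (h t)"
      "dist ((\<gamma> t - \<phi> u) /\<^sub>R t) v < min 1 (e / 2)" "t \<noteq> 0"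
      using eventually_happens'[OF _ ev] by auto
    let ?q = "(\<gamma> t - \<phi> u) /\<^sub>R t"
    have e'_le: "e' \<le> B / 2" "e' \<le> e * B / (8 * (norm v + 1))"
      unfolding e'_def by (rule min.cobounded1 min.cobounded2)+
    have "e' * norm (h t) \<le> B / 2 * norm (h t)" using e'_le(1) by (rule mult_right_mono) simp
    then have "B / 2 * norm (h t) \<le> norm (\<gamma> t - \<phi> u)"
      using B(2)[of "h t"] t(1) norm_triangle_ineq2[of "D (h t)" "D (h t) - (\<gamma> t - \<phi> u)"]
      by (simp add: norm_minus_commute)
    moreover have "norm (\<gamma> t - \<phi> u) = \<bar>t\<bar> * norm ?q" using t(3) by simp
    moreover have "norm ?q \<le> norm v + 1"
      using t(2) norm_triangle_ineq2[of ?q v] by (simp add: dist_norm)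
    ultimately have "B / 2 * norm (h t) \<le> \<bar>t\<bar> * (norm v + 1)"
      by (smt (verit) abs_ge_zero mult_left_mono)
    then have "norm (h t) \<le> 2 / B * (norm v + 1) * \<bar>t\<bar>" using B(1) by (simp add: field_simps)
    then have "e' * norm (h t) \<le> e' * (2 / B * (norm v + 1) * \<bar>t\<bar>)"
      using e' by (intro mult_left_mono) auto
    also have "\<dots> \<le> (e * B / (8 * (norm v + 1))) * (2 / B * (norm v + 1) * \<bar>t\<bar>)"
      using e'_le(2) B(1) nv by (intro mult_right_mono) auto
    also have "\<dots> = e / 4 * \<bar>t\<bar>"
    proof -
      have "e * B / (8 * n) * (2 / B * n * r) = e / 4 * r" if "n > 0" for n r :: real
        using B(1) that by (simp add: field_simps)
      then show ?thesis using nv .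
    qed
    finally have "norm (\<gamma> t - \<phi> u - D (h t)) \<le> e / 4 * \<bar>t\<bar>" using t(1) by simp
    then have "norm ((\<gamma> t - \<phi> u - D (h t)) /\<^sub>R t) \<le> e / 4"
      using t(3) by (rule norm_divideR_le)
    then have "norm (?q - D (h t /\<^sub>R t)) \<le> e / 4"
      using lin by (simp add: linear_cmul scaleR_diff_right)
    then have "dist (D (h t /\<^sub>R t)) v < e"
      using t(2) \<open>e > 0\<close> dist_triangle[of "D (h t /\<^sub>R t)" v ?q] by (simp add: dist_norm norm_minus_commute)
    then show "\<exists>y\<in>range D. dist y v < e" by blast
  qed
  moreover have "closed (range D)"
    using linear_subspace_image[OF lin subspace_UNIV] by (rule closed_subspace)
  ultimately show "v \<in> range D" by simp
qed

text \<open>Over one chart the derivative of the parametrization is a frame that varies continuously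
  on \<open>M \<inter> U\<close>. Compactness leaves finitely many charts, and these are combined by
  case distinction on Borel sets.\<close>

lemma ex_measurable_tangent_frame:
  fixes M :: "'n::euclidean_space set" and T :: "'d::euclidean_space itself"
  assumes "compact M" "smooth_submanifold T M"
  obtains E :: "'n \<Rightarrow> 'd \<Rightarrow> 'n" where "\<And>k. (\<lambda>x. E x k) \<in> borel_measurable borel"
    and "\<And>x. x \<in> M \<Longrightarrow> linear (E x)" "\<And>x. x \<in> M \<Longrightarrow> inj (E x)"
    and "\<And>x. x \<in> M \<Longrightarrow> range (E x) = tangent_space M x"
proof -
  define good :: "('n \<Rightarrow> 'd \<Rightarrow> 'n) \<Rightarrow> 'n set \<Rightarrow> bool" where
    "good E U \<longleftrightarrow> (\<forall>k. (\<lambda>x. E x k) \<in> borel_measurable borel) \<and>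
      (\<forall>x\<in>M \<inter> U. linear (E x) \<and> inj (E x) \<and> range (E x) = tangent_space M x)" for E U
  have "\<exists>U E. open U \<and> p \<in> U \<and> good E U" if p: "p \<in> M" for p
  proof -
    obtain U V and \<phi> :: "'d \<Rightarrow> 'n" where c: "open U" "p \<in> U" "open V" "smooth_on V \<phi>" "inj_on \<phi> V"
      "\<phi> ` V = M \<inter> U" "continuous_on (M \<inter> U) (inv_into V \<phi>)"
      "\<forall>u\<in>V. inj (frechet_derivative \<phi> (at u))"
      using assms(2)[unfolded smooth_submanifold_def, THEN bspec, OF p] by (elim exE conjE)
    \<comment> \<open>The value 0 off \<open>M \<inter> U\<close> makes the frame Borel on the whole
      space; \<open>M \<inter> U\<close> is Borel as \<open>M\<close> is compact and
      \<open>U\<close> open.\<close>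
    define E where "E x k = indicator (M \<inter> U) x *\<^sub>R frechet_derivative \<phi> (at (inv_into V \<phi> x)) k" for x k
    have inv: "inv_into V \<phi> x \<in> V" "\<phi> (inv_into V \<phi> x) = x" if "x \<in> M \<inter> U" for x
      using that c(6) by (auto intro: inv_into_into f_inv_into_f)
    have "good E U" unfolding good_def
    proof (intro conjI allI ballI)
      fix k
      have "continuous_on V (\<lambda>y. frechet_derivative \<phi> (at y) k)"
        using smooth_on_imp(2)[OF c(4)] by (intro continuous_at_imp_continuous_on) auto
      then have "continuous_on (M \<inter> U) (\<lambda>x. frechet_derivative \<phi> (at (inv_into V \<phi> x)) k)"
        by (rule continuous_on_compose2[OF _ c(7)]) (use inv in auto)
      moreover have "M \<inter> U \<in> sets borel"
        using c(1) assms(1) by (auto intro: borel_compact)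
      ultimately show "(\<lambda>x. E x k) \<in> borel_measurable borel"
        unfolding E_def by (intro borel_measurable_continuous_on_indicator)
    next
      fix x assume x: "x \<in> M \<inter> U"
      let ?u = "inv_into V \<phi> x"
      have E: "E x = frechet_derivative \<phi> (at ?u)" using x by (auto simp: E_def)
      have D: "(\<phi> has_derivative frechet_derivative \<phi> (at ?u)) (at ?u)"
        using smooth_on_imp(1)[OF c(4)] inv[OF x] by blast
      show "linear (E x)" using D unfolding E by (rule has_derivative_linear)
      show "inj (E x)" unfolding E using inv[OF x] c(8) by blast
      have "tangent_space M (\<phi> ?u) = range (frechet_derivative \<phi> (at ?u))"
        using inv(1)[OF x] D bspec[OF c(8) inv(1)[OF x]] by (rule tangent_space_chart[OF c(1,3,6,5,7)])
      then show "range (E x) = tangent_space M x" using inv(2)[OF x] by (simp add: E)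
    qed
    then show ?thesis using c by blast
  qed
  then obtain U E where UE: "\<And>p. p \<in> M \<Longrightarrow> open (U p)" "\<And>p. p \<in> M \<Longrightarrow> p \<in> U p"
    "\<And>p. p \<in> M \<Longrightarrow> good (E p) (U p)" by metis
  obtain C where C: "C \<subseteq> M" "finite C" "M \<subseteq> (\<Union>p\<in>C. U p)"
    using compactE_image[OF assms(1), of M U] UE(1,2) by blast
  have "\<exists>E. good E (\<Union>p\<in>C. U p)"
    using C(2,1)
  proof (induction C rule: finite_induct)
    case empty
    have "good (\<lambda>_ _. 0) (\<Union>p\<in>{}. U p)" by (simp add: good_def)
    then show ?case by blast
  next
    case (insert p C)
    then obtain E' where E': "good E' (\<Union>p\<in>C. U p)" by auto
    have p: "good (E p) (U p)" "U p \<in> sets borel" using insert UE by auto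
    have "good (\<lambda>x. if x \<in> U p then E p x else E' x) (\<Union>p\<in>insert p C. U p)"
      using E' p unfolding good_def
      by (auto simp: if_distrib[where f = "\<lambda>f. f _"] intro!: measurable_If_set)
    then show ?case by blast
  qed
  then obtain E where "good E (\<Union>p\<in>C. U p)" ..
  then have meas: "(\<lambda>x. E x k) \<in> borel_measurable borel" for k by (simp add: good_def)
  have E: "linear (E x) \<and> inj (E x) \<and> range (E x) = tangent_space M x" if "x \<in> M" for x
    using \<open>good E (\<Union>p\<in>C. U p)\<close> that C(3) unfolding good_def by blast
  show thesis using meas E by (intro that[of E]) simp_all
qed

text \<open>The \<open>SOME\<close> in \<open>tangent_frame\<close> says something only once a frame
  exists. An injective \<open>D\<close> makes the tangent space have dimension
  \<open>CARD('d)\<close>, so an orthonormal basis of it can be indexed by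
  \<open>'d\<close>.\<close>

lemma tangent_frame_orthonormal:
  fixes M :: "'n::euclidean_space set" and D :: "real^'d::finite \<Rightarrow> 'n"
  assumes "linear D" "inj D" "range D = tangent_space M x"
  shows "tangent_frame TYPE('d) M x i \<bullet> tangent_frame TYPE('d) M x j = (if i = j then 1 else 0)"
    and "span (range (tangent_frame TYPE('d) M x)) = tangent_space M x"
proof -
  have sub: "subspace (range D)" using linear_subspace_image[OF assms(1) subspace_UNIV] .
  have dim: "dim (range D) = CARD('d)"
    using dim_image_eq[of D UNIV] assms(1,2) by simp
  obtain B where B: "B \<subseteq> range D" "pairwise orthogonal B" "\<And>x. x \<in> B \<Longrightarrow> norm x = 1"
    "card B = dim (range D)" "span B = range D"
    using orthonormal_basis_subspace[OF sub] by metis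
  have "finite B" using B(4) dim card_ge_0_finite[of B] by simp
  then obtain e :: "'d \<Rightarrow> 'n" where e: "bij_betw e UNIV B"
    using B(4) dim finite_same_card_bij[of "UNIV :: 'd set" B] by auto
  have "\<exists>e::'d \<Rightarrow> 'n. (\<forall>i j. e i \<bullet> e j = (if i = j then 1 else 0)) \<and> span (range e) = tangent_space M x"
  proof (intro exI conjI allI)
    show "span (range e) = tangent_space M x"
      using e B(5) assms(3) by (simp add: bij_betw_def)
    show "e i \<bullet> e j = (if i = j then 1 else 0)" for i j
    proof (cases "i = j")
      case True
      then show ?thesis using B(3)[of "e j"] e bij_betwE by (fastforce simp: norm_eq_1)
    next
      case False
      then have "e i \<noteq> e j" using e by (auto simp: bij_betw_def inj_def)
      then show ?thesis using B(2) e False bij_betwE by (fastforce simp: pairwise_def orthogonal_def)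
    qed
  qed
  from someI_ex[OF this]
  show "tangent_frame TYPE('d) M x i \<bullet> tangent_frame TYPE('d) M x j = (if i = j then 1 else 0)"
    and "span (range (tangent_frame TYPE('d) M x)) = tangent_space M x"
    unfolding tangent_frame_def by auto
qed

section \<open>Gram determinants under a change of frame\<close>

lemma orthonormal_expansion:
  fixes e :: "'d::finite \<Rightarrow> 'n::real_inner"
  assumes e: "\<And>i j. e i \<bullet> e j = (if i = j then 1 else 0)" and y: "y \<in> span (range e)"
  shows "(\<Sum>b\<in>UNIV. (y \<bullet> e b) *\<^sub>R e b) = y"
  using y
proof (induction rule: span_induct)
  case base
  have "subspace {y. (\<Sum>b\<in>UNIV. (y \<bullet> e b) *\<^sub>R e b) = y}"
    by (rule subspaceI) (auto simp: inner_left_distrib scaleR_left_distrib sum.distrib simp flip: scaleR_sum_right scaleR_scaleR)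
  then show ?case .
next
  case (step y)
  then obtain a where "y = e a" by auto
  moreover have "(e a \<bullet> e b) *\<^sub>R e b = (if b = a then e a else 0)" for b by (simp add: e)
  ultimately show ?case by simp
qed

lemma gram_matrix_linear_combination:
  fixes C :: "real^'d^'d" and g :: "'d::finite \<Rightarrow> 'm::real_inner"
  assumes "\<And>a. f a = (\<Sum>b\<in>UNIV. C $ a $ b *\<^sub>R g b)"
  shows "(\<chi> a b. f a \<bullet> f b) = C ** (\<chi> a b. g a \<bullet> g b) ** transpose C"
proof -
  have "f a \<bullet> f b = (\<Sum>k\<in>UNIV. (\<Sum>j\<in>UNIV. C $ a $ j * (g j \<bullet> g k)) * C $ b $ k)" for a b
  proof -
    have "f a \<bullet> f b = (\<Sum>k\<in>UNIV. \<Sum>j\<in>UNIV. C $ a $ j * (g j \<bullet> g k) * C $ b $ k)"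
      by (simp add: assms inner_sum_left inner_sum_right sum_distrib_left mult_ac)
    then show ?thesis by (simp add: sum_distrib_right)
  qed
  then show ?thesis
    by (simp add: vec_eq_iff matrix_matrix_mult_def transpose_def)
qed

text \<open>Writing the images of the axes under \<open>D\<close> in the frame \<open>e\<close> with
  coefficient matrix \<open>C\<close> multiplies the Gram determinant of every linear image by
  \<open>(det C)\<^sup>2\<close>; the case of the identity identifies this factor. The quotient is
  thus independent of the frame.\<close>

lemma det_gram_change_of_frame:
  fixes e :: "'d::finite \<Rightarrow> 'n::real_inner" and D :: "real^'d \<Rightarrow> 'n" and A :: "'n \<Rightarrow> 'm::real_inner"
  assumes e: "\<And>i j. e i \<bullet> e j = (if i = j then 1 else 0)" and span: "span (range e) = range D"
    and D: "linear D" "inj D" and A: "linear A"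
  shows "det (\<chi> a b. A (D (axis a 1)) \<bullet> A (D (axis b 1)))
       = det (\<chi> a b. D (axis a 1) \<bullet> D (axis b 1)) * det (\<chi> a b. A (e a) \<bullet> A (e b))"
    and "0 < det (\<chi> a b. D (axis a 1) \<bullet> D (axis b 1))"
proof -
  define C :: "real^'d^'d" where "C = (\<chi> a b. D (axis a 1) \<bullet> e b)"
  have expand: "(\<Sum>b\<in>UNIV. (D k \<bullet> e b) *\<^sub>R e b) = D k" for k
    using span by (intro orthonormal_expansion e) auto
  have lin: "T (D (axis a 1)) = (\<Sum>b\<in>UNIV. C $ a $ b *\<^sub>R T (e b))"
    if "linear T" for T :: "'n \<Rightarrow> 'c::real_inner" and a
  proof -
    have "T (D (axis a 1)) = T (\<Sum>b\<in>UNIV. (D (axis a 1) \<bullet> e b) *\<^sub>R e b)" by (simp only: expand)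
    also have "\<dots> = (\<Sum>b\<in>UNIV. C $ a $ b *\<^sub>R T (e b))"
      using that by (simp add: linear_sum linear_cmul C_def)
    finally show ?thesis .
  qed
  have "(\<chi> a b. e a \<bullet> e b) = (mat 1 :: real^'d^'d)" by (simp add: e mat_def)
  then have 1: "det (\<chi> a b. D (axis a 1) \<bullet> D (axis b 1)) = (det C)\<^sup>2"
    using gram_matrix_linear_combination[OF lin[of "\<lambda>y. y"]]
    by (simp add: linear_id[unfolded id_def] det_mul det_transpose power2_eq_square)
  show "det (\<chi> a b. A (D (axis a 1)) \<bullet> A (D (axis b 1)))
       = det (\<chi> a b. D (axis a 1) \<bullet> D (axis b 1)) * det (\<chi> a b. A (e a) \<bullet> A (e b))"
    unfolding 1 gram_matrix_linear_combination[OF lin[OF A]] by (simp add: det_mul det_transpose power2_eq_square)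
  \<comment> \<open>A vector in the kernel of the transpose of \<open>C\<close> has zero coordinates
    in the frame \<open>e\<close> after applying \<open>D\<close>, so injectivity of
    \<open>D\<close> makes it zero.\<close>
  have "det C \<noteq> 0"
  proof
    assume "det C = 0"
    then have "\<not> invertible (transpose C)" by (simp add: invertible_det_nz det_transpose)
    then obtain r where r: "r \<noteq> 0" "transpose C *v r = 0"
      using matrix_left_invertible_ker[of "transpose C"] invertible_left_inverse[of "transpose C"] by auto
    have "D r = D (\<Sum>a\<in>UNIV. r $ a *\<^sub>R axis a 1)"
      using basis_expansion[of r] by (simp add: scalar_mult_eq_scaleR)
    also have "\<dots> = (\<Sum>a\<in>UNIV. r $ a *\<^sub>R D (axis a 1))"
      using D(1) by (simp add: linear_sum linear_cmul)
    finally have "D r \<bullet> e b = (transpose C *v r) $ b" for b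
      by (simp add: inner_sum_left C_def transpose_def matrix_vector_mult_def mult_ac)
    then have "D r = 0" using r(2) expand[of r] by simp
    then show False using D(2) r(1) linear_0[OF D(1)] by (auto dest: injD[of D r 0])
  qed
  then show "0 < det (\<chi> a b. D (axis a 1) \<bullet> D (axis b 1))" unfolding 1 by simp
qed

section \<open>Moments of the image volume\<close>

text \<open>The second moment is the sum of the variance and the squared mean, both nonnegative. The
  case distinctions handle the convention that a non-integrable function has integral 0: if
  \<open>V\<close> is not integrable, its mean is 0 and the centered moment is the second moment
  itself.\<close>

lemma (in prob_space) square_expectation_and_variance_le:
  fixes V :: "'a \<Rightarrow> real"
  assumes V: "AE \<omega> in M. ennreal ((V \<omega>)\<^sup>2) \<le> K \<omega>" and K: "(\<integral>\<^sup>+\<omega>. K \<omega> \<partial>M) \<le> ennreal B" and "0 \<le> B"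
  shows "(expectation V)\<^sup>2 \<le> B \<and> expectation (\<lambda>\<omega>. (V \<omega> - expectation V)\<^sup>2) \<le> B"
proof -
  have N: "(\<integral>\<^sup>+\<omega>. ennreal ((V \<omega>)\<^sup>2) \<partial>M) \<le> ennreal B"
    using nn_integral_mono_AE[OF V] K by (rule order_trans)
  have I: "expectation (\<lambda>\<omega>. (V \<omega>)\<^sup>2) \<le> B"
  proof (cases "integrable M (\<lambda>\<omega>. (V \<omega>)\<^sup>2)")
    case True
    then have "ennreal (expectation (\<lambda>\<omega>. (V \<omega>)\<^sup>2)) \<le> ennreal B"
      using N by (subst (asm) nn_integral_eq_integral) auto
    then show ?thesis using \<open>0 \<le> B\<close> by simp
  qed (simp add: not_integrable_integral_eq \<open>0 \<le> B\<close>)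
  show ?thesis
  proof (cases "integrable M V")
    case True
    then have [measurable]: "V \<in> borel_measurable M" by simp
    have "integrable M (\<lambda>\<omega>. (V \<omega>)\<^sup>2)"
      using N by (intro integrableI_bounded) (auto simp: less_top[symmetric] top_unique)
    then have "variance V = expectation (\<lambda>\<omega>. (V \<omega>)\<^sup>2) - (expectation V)\<^sup>2"
      using True by (intro variance_eq)
    then show ?thesis using I variance_positive[of V] by (smt (verit) zero_le_power2)
  next
    case False
    then show ?thesis using I \<open>0 \<le> B\<close> by (simp add: not_integrable_integral_eq)
  qed
qed

text \<open>Cauchy-Schwarz against the constant 1 settles the integrable case; otherwise the left
  side is 0. This covers integrands built on \<open>tangent_frame\<close>, whose measurability is
  unknown.\<close>

lemma (in prob_space) square_expectation_le_nn_integral: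
  fixes f :: "'a \<Rightarrow> real"
  shows "ennreal ((expectation f)\<^sup>2) \<le> (\<integral>\<^sup>+x. ennreal ((f x)\<^sup>2) \<partial>M)"
proof (cases "integrable M f")
  case True
  then have [measurable]: "f \<in> borel_measurable M" by simp
  have "ennreal ((expectation f)\<^sup>2) = (ennreal \<bar>expectation f\<bar>)\<^sup>2"
    by (simp add: ennreal_power)
  also have "\<dots> \<le> (\<integral>\<^sup>+x. ennreal \<bar>f x\<bar> \<partial>M)\<^sup>2"
    using integral_norm_bound_ennreal[OF True] by (intro power_mono) auto
  also have "\<dots> = (\<integral>\<^sup>+x. ennreal \<bar>f x\<bar> * 1 \<partial>M)\<^sup>2" by simp
  also have "\<dots> \<le> (\<integral>\<^sup>+x. (ennreal \<bar>f x\<bar>)\<^sup>2 \<partial>M) * (\<integral>\<^sup>+x. 1\<^sup>2 \<partial>M)"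
    by (rule Cauchy_Schwarz_nn_integral) auto
  also have "\<dots> = (\<integral>\<^sup>+x. ennreal ((f x)\<^sup>2) \<partial>M)"
    by (simp add: ennreal_power emeasure_space_1)
  finally show ?thesis .
qed (simp add: not_integrable_integral_eq)

text \<open>Countable additivity of the outer measure on Borel sets is never needed: were it to fail,
  \<open>hausdorff_measure\<close> would be the zero measure, which the assumption on \<open>M\<close> excludes.\<close>
lemma sets_hausdorff_measure [measurable_cong, simp]: "sets (hausdorff_measure d) = sets borel"
  unfolding hausdorff_measure_def
  using sets.sigma_sets_eq[of borel] by (subst sets_measure_of) auto

lemma measurable_dnet:
  fixes X E :: "'a \<Rightarrow> real^'n"
  assumes "X \<in> borel_measurable M" "E \<in> borel_measurable M" "\<And>k. (\<lambda>\<omega>. T \<omega> k) \<in> borel_measurable M"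
  shows "(\<lambda>\<omega>. (dnet w L (T \<omega>) (X \<omega>) (E \<omega>) :: real^'m) $ k) \<in> borel_measurable M"
  unfolding dnet_def vec_lambda_beta
  by (intro borel_measurable_sum borel_measurable_times assms measurable_dact[OF assms])

text \<open>Two replacements at once: the true Jacobian by \<open>dnet\<close>, and the chosen
  orthonormal frame by the frame of \<open>D\<close>, whose lack of orthonormality the denominator
  corrects.\<close>

lemma wedge_norm_jac_apply_net:
  fixes x :: "real^'n" and D :: "real^'d::finite \<Rightarrow> real^'n"
  assumes D: "linear D" "inj D" "range D = tangent_space M x"
    and nz: "\<And>l i. Suc l < L \<Longrightarrow> i < w (Suc l) \<Longrightarrow> pre_act w th l x i \<noteq> 0"
  shows "(wedge_norm (\<lambda>i::'d. jac_apply (net w L th :: real^'n \<Rightarrow> real^'m) x (tangent_frame TYPE('d) M x i)))\<^sup>2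
    = det (\<chi> a b. (dnet w L th x (D (axis a 1)) :: real^'m) \<bullet> dnet w L th x (D (axis b 1)))
      / det (\<chi> a b. D (axis a 1) \<bullet> D (axis b 1))"
proof -
  let ?e = "tangent_frame TYPE('d) M x" and ?J = "dnet w L th x :: real^'n \<Rightarrow> real^'m"
  note e = tangent_frame_orthonormal[OF D]
  have J: "(net w L th has_derivative ?J) (at x)" using nz by (rule has_derivative_net)
  have jac: "jac_apply (net w L th) x = ?J"
    using differentiableI[OF J] frechet_derivative_at[OF J] by (simp add: jac_apply_def fun_eq_iff)
  have gram: "det (\<chi> a b. ?J (D (axis a 1)) \<bullet> ?J (D (axis b 1)))
       = det (\<chi> a b. D (axis a 1) \<bullet> D (axis b 1)) * det (\<chi> a b. ?J (?e a) \<bullet> ?J (?e b))"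
    and pos: "0 < det (\<chi> a b. D (axis a 1) \<bullet> D (axis b 1))"
    using det_gram_change_of_frame[OF e(1) _ D(1,2) has_derivative_linear[OF J]] e(2) D(3) by auto
  have "0 \<le> det (\<chi> a b. ?J (?e a) \<bullet> ?J (?e b))"
    using det_gram_nonneg[of UNIV "\<lambda>k a. ?J (?e a) $ k"] by (simp add: inner_vec_def)
  then show ?thesis
    using pos by (simp add: jac wedge_norm_def gram)
qed

theorem theorem5:
  fixes w :: "nat \<Rightarrow> nat" and L :: nat and Cb :: real and M :: "(real^'n) set"
  assumes "L \<ge> 1"
    and "\<forall>l\<le>L. w l \<ge> 1"
    and "w 0 = CARD('n)" and "w L = CARD('m)"
    and "Cb > 0"
    and "\<forall>l\<le>L. CARD('d::finite) \<le> w l"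
    and "compact M" and "smooth_submanifold TYPE(real^'d) M"
    and "emeasure (hausdorff_measure CARD('d)) M = 1"
  defines "P \<equiv> param_measure w L Cb"
    and "V \<equiv> \<lambda>th. image_volume TYPE('d) M (net w L th :: real^'n \<Rightarrow> real^'m)"
    and "B \<equiv> (real CARD('m) / real CARD('n)) ^ CARD('d)
             * exp (- real (CARD('d) choose 2) * (\<Sum>l=1..L. 1 / real (w l)))"
  shows "(\<integral>th. V th \<partial>P)\<^sup>2 \<le> B \<and> (\<integral>th. (V th - (\<integral>th'. V th' \<partial>P))\<^sup>2 \<partial>P) \<le> B"
proof -
  \<comment> \<open>At indices outside \<open>param_set w L\<close> a width may be 0, and then
    \<open>param_var\<close> is 0 as well; the value 1 there meets the positivity that
    \<open>gaussian_family\<close> demands at all indices.\<close>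
  define v where "v k = (if 0 < param_var w L Cb k then param_var w L Cb k else 1)" for k
  have v_pos: "0 < v k" for k by (simp add: v_def)
  have v: "v k = param_var w L Cb k" if "k \<in> param_set w L" for k
  proof -
    have "0 < w (l - 1)" if "l \<le> L" for l using assms(2) that by (auto simp: Suc_le_eq)
    then have "0 < param_var w L Cb k" using that assms(5) by (auto simp: param_set_def)
    then show ?thesis by (simp add: v_def)
  qed
  interpret G: gaussian_family v "param_set w L"
    using v_pos finite_param_set by unfold_locales
  have P: "P = PiM (param_set w L) (\<lambda>k. centered_normal (v k))"
    unfolding P_def using v by (rule param_measure_eq_PiM)
  interpret P: prob_space P unfolding P by (rule G.P.prob_space_axioms)
  define \<nu> where "\<nu> = restrict_space (hausdorff_measure CARD('d)) M"
  have M_sets: "M \<in> sets (hausdorff_measure CARD('d))"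
    using assms(7) by (simp add: borel_compact)
  have sp: "space \<nu> = M" using sets.sets_into_space[OF M_sets] by (auto simp: \<nu>_def space_restrict_space)
  have "emeasure \<nu> (space \<nu>) = 1"
    unfolding sp using M_sets assms(9) by (simp add: \<nu>_def emeasure_restrict_space)
  then interpret N: prob_space \<nu> by (rule prob_spaceI)
  interpret NP: pair_sigma_finite \<nu> P ..
  obtain E :: "real^'n \<Rightarrow> real^'d \<Rightarrow> real^'n" where E: "\<And>k. (\<lambda>x. E x k) \<in> borel_measurable borel"
    "\<And>x. x \<in> M \<Longrightarrow> linear (E x)" "\<And>x. x \<in> M \<Longrightarrow> inj (E x)"
    "\<And>x. x \<in> M \<Longrightarrow> range (E x) = tangent_space M x"
    using ex_measurable_tangent_frame[OF assms(7,8)] by blast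
  define g where "g x = det (\<chi> a b. E x (axis a 1) \<bullet> E x (axis b 1))" for x
  \<comment> \<open>A jointly measurable substitute for the squared wedge norm, to be shown equal to
    it almost everywhere on \<open>M\<close> for almost every parameter.\<close>
  define R where "R x \<theta> = det (\<chi> a b. (dnet w L \<theta> x (E x (axis a 1)) :: real^'m) \<bullet> dnet w L \<theta> x (E x (axis b 1))) / g x"
    for x \<theta>
  define f where "f \<theta> x = wedge_norm (\<lambda>i::'d. jac_apply (net w L \<theta> :: real^'n \<Rightarrow> real^'m) x (tangent_frame TYPE('d) M x i))"
    for \<theta> x
  have V: "V \<theta> = (\<integral>x. f \<theta> x \<partial>\<nu>)" for \<theta>
    unfolding V_def image_volume_def f_def set_lebesgue_integral_def \<nu>_def
    using M_sets by (subst integral_restrict_space) (auto simp: Int_absorb2)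
  have "0 \<le> B" by (simp add: B_def)

  have id: "(\<lambda>x. x) \<in> borel_measurable \<nu>"
    unfolding \<nu>_def by (intro measurable_restrict_space1) (simp cong: measurable_cong_sets)
  have X: "fst \<in> borel_measurable (\<nu> \<Otimes>\<^sub>M P)"
    using measurable_compose[OF measurable_fst[of \<nu> P] id] .
  have EX: "(\<lambda>z. E (fst z) k) \<in> borel_measurable (\<nu> \<Otimes>\<^sub>M P)" for k
    using measurable_compose[OF X E(1)] .
  have \<theta>: "(\<lambda>z. snd z k) \<in> borel_measurable (\<nu> \<Otimes>\<^sub>M P)" for k
    using measurable_compose[OF measurable_snd[of \<nu> P, unfolded P] G.measurable_coordinate] unfolding P .
  have R_meas: "(\<lambda>z. R (fst z) (snd z)) \<in> borel_measurable (\<nu> \<Otimes>\<^sub>M P)"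
    unfolding R_def g_def inner_vec_def inner_real_def
    by (intro borel_measurable_divide borel_measurable_det_sum_products measurable_dnet[OF X EX \<theta>]
        measurable_compose[OF EX borel_measurable_nth])

  have "AE \<theta> in P. \<forall>l i. Suc l < L \<longrightarrow> i < w (Suc l) \<longrightarrow> (AE x in \<nu>. pre_act w \<theta> l x i \<noteq> 0)"
  proof (unfold AE_all_countable, intro allI)
    fix l i
    have [measurable]: "(\<lambda>z. pre_act w (snd z) l (fst z) i) \<in> borel_measurable (\<nu> \<Otimes>\<^sub>M P)"
      by (rule measurable_pre_act[OF X \<theta>])
    show "AE \<theta> in P. Suc l < L \<longrightarrow> i < w (Suc l) \<longrightarrow> (AE x in \<nu>. pre_act w \<theta> l x i \<noteq> 0)"
    proof (cases "Suc l < L \<and> i < w (Suc l)")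
      case True
      then have "AE x in \<nu>. AE \<theta> in P. pre_act w \<theta> l x i \<noteq> 0"
        unfolding P by (intro AE_I2 AE_pre_act_nonzero v_pos) auto
      then have "AE \<theta> in P. AE x in \<nu>. pre_act w \<theta> l x i \<noteq> 0"
        by (subst (asm) NP.AE_commute) measurable
      then show ?thesis by eventually_elim simp
    qed auto
  qed
  then have bound: "AE \<theta> in P. ennreal ((V \<theta>)\<^sup>2) \<le> (\<integral>\<^sup>+x. ennreal (R x \<theta>) \<partial>\<nu>)"
  proof eventually_elim
    case (elim \<theta>)
    then have "AE x in \<nu>. \<forall>l i. Suc l < L \<longrightarrow> i < w (Suc l) \<longrightarrow> pre_act w \<theta> l x i \<noteq> 0"
      by (simp add: AE_all_countable)
    moreover have "AE x in \<nu>. x \<in> M" using sp by (intro AE_I2) simp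
    ultimately have "AE x in \<nu>. (f \<theta> x)\<^sup>2 = R x \<theta>"
    proof eventually_elim
      case (elim x)
      then show ?case
        unfolding f_def R_def g_def by (intro wedge_norm_jac_apply_net E) auto
    qed
    then have "(\<integral>\<^sup>+x. ennreal ((f \<theta> x)\<^sup>2) \<partial>\<nu>) = (\<integral>\<^sup>+x. ennreal (R x \<theta>) \<partial>\<nu>)"
      by (intro nn_integral_cong_AE) (auto elim: eventually_mono)
    then show ?case using N.square_expectation_le_nn_integral[of "f \<theta>"] by (simp add: V)
  qed
  have "(\<integral>\<^sup>+\<theta>. (\<integral>\<^sup>+x. ennreal (R x \<theta>) \<partial>\<nu>) \<partial>P) = (\<integral>\<^sup>+x. (\<integral>\<^sup>+\<theta>. ennreal (R x \<theta>) \<partial>P) \<partial>\<nu>)"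
    using R_meas by (intro NP.Fubini') (simp add: case_prod_unfold)
  also have "\<dots> \<le> (\<integral>\<^sup>+x. ennreal B \<partial>\<nu>)"
  proof (intro nn_integral_mono)
    fix x assume "x \<in> space \<nu>"
    then have x: "x \<in> M" by (simp add: sp)
    let ?G = "\<lambda>\<theta>. det (\<chi> a b. (dnet w L \<theta> x (E x (axis a 1)) :: real^'m) \<bullet> dnet w L \<theta> x (E x (axis b 1)))"
    note D = E(2-4)[OF x]
    note e = tangent_frame_orthonormal[OF D]
    have g: "0 < g x"
      unfolding g_def using e(2) D(3)
      by (intro det_gram_change_of_frame(2)[OF e(1) _ D(1,2), of "\<lambda>y. y"]) (auto simp: linear_id[unfolded id_def])
    have Gm: "?G \<in> borel_measurable P"
      unfolding inner_vec_def inner_real_def P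
      by (intro borel_measurable_det_sum_products measurable_dnet G.measurable_coordinate) simp_all
    have "(\<integral>\<^sup>+\<theta>. ennreal (R x \<theta>) \<partial>P) = (\<integral>\<^sup>+\<theta>. ennreal (1 / g x) * ennreal (?G \<theta>) \<partial>P)"
      using g by (intro nn_integral_cong) (simp add: R_def ennreal_mult'[symmetric])
    also have "\<dots> = ennreal (1 / g x) * (\<integral>\<^sup>+\<theta>. ennreal (?G \<theta>) \<partial>P)"
      using Gm by (intro nn_integral_cmult) simp
    \<comment> \<open>The fixed-point bound for the frame \<open>E x\<close> carries its Gram
      determinant \<open>g x\<close>, which the normalization \<open>1 / g x\<close>
      cancels.\<close>
    also have "\<dots> \<le> ennreal (1 / g x) * ennreal (B * g x)"
      unfolding P B_def g_def using assms(1-4,6) v_pos v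
      by (intro mult_left_mono nn_integral_det_dnet_le) auto
    also have "\<dots> = ennreal B"
      using g \<open>0 \<le> B\<close> by (simp add: ennreal_mult'[symmetric])
    finally show "(\<integral>\<^sup>+\<theta>. ennreal (R x \<theta>) \<partial>P) \<le> ennreal B" .
  qed
  also have "\<dots> = ennreal B" by (simp add: N.emeasure_space_1)
  finally show ?thesis
    using bound \<open>0 \<le> B\<close> by (intro P.square_expectation_and_variance_le)
qed

end
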